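(* Let $F$ be a natural exponential family on $\mathbb{R}$ and let $\mu$ be an element of $F$ with mean $m_o$. Let $f_\mu(x,m)=\exp\{\psi_\mu(m)x-k_\mu(\psi_\mu(m))\}$ for $x\in\mathbb{R}$, $m\in M_F$, and consider the polynomials $(P_n)_{n\in\mathbb{N}}$ defined by $P_n(x)=\frac{\partial^n}{\partial m^n}f_\mu(x,m)\big|_{m=m_o}$. Then the three following statements are equivalent: (i) The polynomials $(P_n)_{n\in\mathbb{N}}$ are $\mu$-$2$-orthogonal. (ii) $F$ is cubic. (iii) There exist real numbers $a_0,a_1,a_2,a_3$ such that, for all $n\ge2$ (as an identity of polynomials in $x$), $$xP_n(x)=a_3A_n^3P_{n-2}(x)+n(a_2(n-1)+1)P_{n-1}(x)+(na_1+m_o)P_n(x)+a_0P_{n+1}(x),$$ with $A_n^3=n(n-1)(n-2)$. Furthermore, in this case, for all $m\in M_F$, $$V_F(m)=a_3(m-m_o)^3+a_2(m-m_o)^2+a_1(m-m_o)+a_0.$$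
   Context: $\mathbb{N}=\{0,1,2,\dots\}$ and $\mathbb{N}^*=\{1,2,\dots\}$. For a positive Radon measure $\nu$ on $\mathbb{R}$, let $L_\nu(\theta)=\int_{\mathbb{R}}\exp(\theta x)\,\nu(dx)\le+\infty$, and let $\Theta(\nu)$ be the interior of $\{\theta\in\mathbb{R}: L_\nu(\theta)<\infty\}$. $\mathcal{M}(\mathbb{R})$ is the set of such $\nu$ with $\Theta(\nu)\neq\emptyset$ and $\nu$ not concentrated on one point. For $\nu\in\mathcal{M}(\mathbb{R})$ put $k_\nu=\log L_\nu$ on $\Theta(\nu)$; it is strictly convex and real analytic. For $\theta\in\Theta(\nu)$ let $P(\theta,\nu)(dx)=\exp(\theta x-k_\nu(\theta))\,\nu(dx)$. The natural exponential family (NEF) generated by $\nu$ is $F=F(\nu)=\{P(\theta,\nu):\theta\in\Theta(\nu)\}$. Its domain of the means is the open interval $M_F=k_\nu'(\Theta(\nu))$, and $\psi_\nu:M_F\to\Theta(\nu)$ is the inverse of $k_\nu'$. For $m\in M_F$, $P(m,F)=P(\psi_\nu(m),\nu)$ is the element of $F$ with mean $m$. Any element $\mu$ of $F$ itself generates $F$ (i.e. $F(\mu)=F$), so $k_\mu$ and $\psi_\mu$ are defined in the same way with $\nu=\mu$; if $\mu$ has mean $m_o$ then $m_o\in M_F$, $0\in\Theta(\mu)$ and $\psi_\mu(m_o)=0$. Each $P_n$ is a polynomial in $x$ of degree $n$. The variance function of $F$ is $V_F(m)=\int_{\mathbb{R}}(x-m)^2P(m,F)(dx)=k_\mu''(\psi_\mu(m))=(\psi_\mu'(m))^{-1}$,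 $m\in M_F$. $F$ is called cubic if $V_F$ is (the restriction to $M_F$ of) a polynomial of degree less than or equal to $3$. Let $\mu$ be a measure on $\mathbb{R}$ with $\int|x|^n\mu(dx)<\infty$ for all $n\in\mathbb{N}$. A family $(Q_n)_{n\in\mathbb{N}}$ of polynomials on $\mathbb{R}$ is $\mu$-$2$-orthogonal if for all $n,q\in\mathbb{N}^*$ one has $\int Q_n(x)Q_q(x)\,\mu(dx)=0$ whenever $n\ge2q$, and $\int Q_n(x)\,\mu(dx)=0$. *)

theory Defs
  imports "HOL-Analysis.Analysis" "HOL-Computational_Algebra.Polynomial"
begin

text \<open>Every Borel measure on the real line that is finite on compact sets is automatically
  regular, so no regularity condition appears here.\<close>

definition radon_measure :: "real measure \<Rightarrow> bool" where
  "radon_measure \<nu> \<longleftrightarrow> sets \<nu> = sets borel \<and> (\<forall>K. compact K \<longrightarrow> emeasure \<nu> K < \<infinity>)"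

definition laplace :: "real measure \<Rightarrow> real \<Rightarrow> ennreal" where
  "laplace \<nu> \<theta> = (\<integral>\<^sup>+ x. ennreal (exp (\<theta> * x)) \<partial>\<nu>)"

definition Theta :: "real measure \<Rightarrow> real set" where
  "Theta \<nu> = interior {\<theta>. laplace \<nu> \<theta> < \<infinity>}"

text \<open>The class \<open>\<M>(\<real>)\<close>. The last condition also excludes the zero measure.\<close>

definition nef_measures :: "real measure set" where
  "nef_measures =
     {\<nu>. radon_measure \<nu> \<and> Theta \<nu> \<noteq> {} \<and> \<not> (\<exists>c. emeasure \<nu> (- {c}) = 0)}"

text \<open>Only meaningful for \<open>\<theta> \<in> Theta \<nu>\<close>, where the Laplace transform is finite.\<close>

definition cumulant :: "real measure \<Rightarrow> real \<Rightarrow> real" where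
  "cumulant \<nu> \<theta> = ln (enn2real (laplace \<nu> \<theta>))"

definition nef_element :: "real \<Rightarrow> real measure \<Rightarrow> real measure" where
  "nef_element \<theta> \<nu> = density \<nu> (\<lambda>x. ennreal (exp (\<theta> * x - cumulant \<nu> \<theta>)))"

definition NEF :: "real measure \<Rightarrow> real measure set" where
  "NEF \<nu> = {nef_element \<theta> \<nu> | \<theta>. \<theta> \<in> Theta \<nu>}"

text \<open>The domain of the means, the element with given mean, and the variance function belong to
  the family \<open>F = NEF \<nu>\<close>; as in their usual definition they are expressed through a generator
  \<open>\<nu>\<close>, on whose choice they do not depend.\<close>

definition mean_domain :: "real measure \<Rightarrow> real set" where
  "mean_domain \<nu> = deriv (cumulant \<nu>) ` Theta \<nu>"

definition psi :: "real measure \<Rightarrow> real \<Rightarrow> real" where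
  "psi \<nu> = the_inv_into (Theta \<nu>) (deriv (cumulant \<nu>))"

definition element_with_mean :: "real \<Rightarrow> real measure \<Rightarrow> real measure" where
  "element_with_mean m \<nu> = nef_element (psi \<nu> m) \<nu>"

definition variance_function :: "real measure \<Rightarrow> real \<Rightarrow> real" where
  "variance_function \<nu> m = (\<integral>x. (x - m)\<^sup>2 \<partial>(element_with_mean m \<nu>))"

definition cubic_NEF :: "real measure \<Rightarrow> bool" where
  "cubic_NEF \<nu> \<longleftrightarrow>
     (\<exists>p :: real poly. degree p \<le> 3 \<and>
        (\<forall>m \<in> mean_domain \<nu>. variance_function \<nu> m = poly p m))"

definition two_orthogonal :: "real measure \<Rightarrow> (nat \<Rightarrow> real \<Rightarrow> real) \<Rightarrow> bool" where
  "two_orthogonal \<mu> Q \<longleftrightarrow>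
     (\<forall>n. integrable \<mu> (\<lambda>x. \<bar>x\<bar> ^ n)) \<and>
     (\<forall>n. \<exists>p :: real poly. \<forall>x. Q n x = poly p x) \<and>
     (\<forall>n\<ge>1. \<forall>q\<ge>1. n \<ge> 2 * q \<longrightarrow> (\<integral>x. Q n x * Q q x \<partial>\<mu>) = 0) \<and>
     (\<forall>n\<ge>1. (\<integral>x. Q n x \<partial>\<mu>) = 0)"

definition nef_density :: "real measure \<Rightarrow> real \<Rightarrow> real \<Rightarrow> real" where
  "nef_density \<mu> x m = exp (psi \<mu> m * x - cumulant \<mu> (psi \<mu> m))"

definition nef_poly :: "real measure \<Rightarrow> real \<Rightarrow> nat \<Rightarrow> real \<Rightarrow> real" where
  "nef_poly \<mu> m\<^sub>o n x = (deriv ^^ n) (\<lambda>m. nef_density \<mu> x m) m\<^sub>o"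

definition cubic_recurrence ::
    "(nat \<Rightarrow> real \<Rightarrow> real) \<Rightarrow> real \<Rightarrow> real \<Rightarrow> real \<Rightarrow> real \<Rightarrow> real \<Rightarrow> bool" where
  "cubic_recurrence P m\<^sub>o a\<^sub>0 a\<^sub>1 a\<^sub>2 a\<^sub>3 \<longleftrightarrow>
     (\<forall>n\<ge>2. \<forall>x.
        x * P n x =
          a\<^sub>3 * (real n * (real n - 1) * (real n - 2)) * P (n - 2) x
          + real n * (a\<^sub>2 * (real n - 1) + 1) * P (n - 1) x
          + (real n * a\<^sub>1 + m\<^sub>o) * P n x
          + a\<^sub>0 * P (n + 1) x)"

end

theory Submission
  imports Defs "HOL-Complex_Analysis.Laurent_Convergence"
begin

text \<open>
  Everything is read off from Taylor coefficients at \<open>m\<^sub>o\<close>. Write \<open>k\<close> for the cumulant function of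
  \<open>\<mu>\<close>, so that \<open>\<psi>\<close> is the inverse function of \<open>k'\<close> and \<open>V(m) = k''(\<psi>(m))\<close>. The density satisfies
  \<open>V(m) \<partial>\<^sub>m f(x,m) = (x - m) f(x,m)\<close>. Comparing coefficients of \<open>(m - m\<^sub>o)\<^sup>n\<close> turns this
  differential equation into a recurrence that expresses \<open>x P\<^sub>n\<close> through all the \<open>P\<^sub>j\<close>, \<open>j \<le> n + 1\<close>,
  with the Taylor coefficients of \<open>V\<close> as its constants. It shows that \<open>P\<^sub>n\<close> has degree \<open>n\<close>, and, since
  polynomials of distinct degrees are linearly independent, that the cubic recurrence holds for all
  \<open>n \<ge> 2\<close> exactly when the Taylor series of \<open>V\<close> is the cubic polynomial with the same constants
  (\<open>recurrence_iff\<close>).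

  For orthogonality, \<open>\<integral>P\<^sub>n(x) x\<^sup>j \<mu>(dx)\<close> is the \<open>n\<close>-th derivative at \<open>m\<^sub>o\<close> of the moment
  \<open>E\<^sub>j(m) = \<integral>x\<^sup>j f(x,m) \<mu>(dx)\<close>. From \<open>E\<^sub>j\<^sub>+\<^sub>1 = V E\<^sub>j' + m E\<^sub>j\<close> one gets \<open>E\<^sub>2 = V + m\<^sup>2\<close>, so orthogonality
  of \<open>P\<^sub>2\<close> to all \<open>P\<^sub>n\<close> with \<open>n \<ge> 4\<close> kills the coefficients of \<open>V\<close> beyond the third; conversely a cubic \<open>V\<close>
  raises the degree by at most two at each step, so \<open>E\<^sub>j\<close> has degree at most \<open>2j - 1\<close> for \<open>j \<ge> 1\<close>
  (\<open>two_orthogonal_iff\<close>).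

  It remains to pass from the Taylor series of \<open>V\<close> at one point to \<open>V\<close> on the whole domain of the
  means. In the variable \<open>\<theta>\<close> the statement becomes \<open>k'' = p \<circ> k'\<close> on the interval \<open>\<Theta>(\<mu>)\<close>, an identity
  between real analytic functions, so the identity theorem applies (\<open>variance_cubic_iff\<close>).

  Derivatives in \<open>m\<close> are also computed in the variable \<open>\<theta>\<close>. Since \<open>(g \<circ> \<psi>)' = (g'/k'') \<circ> \<psi>\<close>, each
  differentiation of \<open>g \<circ> \<psi>\<close> only replaces \<open>g\<close> by another analytic function of \<open>\<theta>\<close>.
  Up to factorials, the derivatives at \<open>m\<^sub>o\<close> are the coefficients of the formal composition of the
  series of \<open>g\<close> with the formal inverse \<open>\<Psi>\<close> of the series of \<open>k' - m\<^sub>o\<close> (\<open>higher_deriv_compose_psi\<close>). All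
  computations are therefore done with formal power series.
\<close>

section \<open>Power series expansions and the identity theorem\<close>

text \<open>Dividing by \<open>x\<close> to the power of the subdegree leaves a function that is continuous with a
  nonzero value at the origin. This is the isolation of zeros.\<close>

lemma has_fps_expansion_eventually_nonzero:
  fixes f :: "'a::{banach, real_normed_field} \<Rightarrow> 'a"
  assumes f: "f has_fps_expansion F" and F: "F \<noteq> 0"
  shows "eventually (\<lambda>x. f x \<noteq> 0) (at 0)"
proof -
  define n where "n = subdegree F"
  define g where "g = (\<lambda>x. if x = 0 then fps_nth F n else f x / x ^ n)"
  have "g has_fps_expansion fps_shift n F"
    unfolding g_def by (rule has_fps_expansion_shift[OF f]) (simp_all add: n_def)
  then have "isCont g 0"
    by (rule has_fps_expansion_imp_continuous)
  then have "g \<midarrow>0\<rightarrow> g 0"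
    by (simp add: isCont_def)
  moreover have "g 0 \<noteq> 0"
    using F by (simp add: g_def n_def)
  ultimately have "eventually (\<lambda>x. g x \<noteq> 0) (at 0)"
    by (rule tendsto_imp_eventually_ne)
  moreover have "eventually (\<lambda>x::'a. x \<noteq> 0) (at 0)"
    by (simp add: eventually_at_filter)
  ultimately show ?thesis
    by eventually_elim (auto simp: g_def)
qed

lemma has_fps_expansion_eventually_zero_imp_0:
  fixes f :: "'a::{banach, real_normed_field} \<Rightarrow> 'a"
  assumes "f has_fps_expansion F" and "eventually (\<lambda>x. f x = 0) (nhds 0)"
  shows "F = 0"
proof (rule ccontr)
  assume "F \<noteq> 0"
  then have "eventually (\<lambda>x. f x \<noteq> 0) (at 0)"
    by (rule has_fps_expansion_eventually_nonzero[OF assms(1)])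
  moreover have "eventually (\<lambda>x. f x = 0) (at 0)"
    using assms(2) by (simp add: eventually_at_filter eventually_mono)
  ultimately have "eventually (\<lambda>x. False) (at (0::'a))"
    by eventually_elim simp
  then show False by simp
qed

lemma has_fps_expansion_eventually_DERIV:
  fixes f :: "'a::{banach, real_normed_field} \<Rightarrow> 'a"
  assumes "f has_fps_expansion F"
  shows "eventually (\<lambda>x. (f has_field_derivative deriv f x) (at x)) (nhds 0)"
proof -
  have "eventually (\<lambda>x. x \<in> eball 0 (fps_conv_radius F)) (nhds (0::'a))"
    using assms by (intro eventually_nhds_in_open) (auto simp: has_fps_expansion_def zero_ereal_def)
  moreover have "eventually (\<lambda>x. eventually (\<lambda>y. eval_fps F y = f y) (nhds x)) (nhds 0)"
    using assms by (simp add: has_fps_expansion_def eventually_eventually)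
  ultimately show ?thesis
  proof eventually_elim
    case (elim x)
    have "(eval_fps F has_field_derivative eval_fps (fps_deriv F) x) (at x)"
      using elim(1) by (intro has_field_derivative_eval_fps) (simp add: in_eball_iff dist_norm)
    moreover have "(eval_fps F has_field_derivative D) (at x) = (f has_field_derivative D) (at x)" for D
      using elim(2) by (intro DERIV_cong_ev) simp_all
    ultimately show ?case
      by (metis DERIV_imp_deriv)
  qed
qed

text \<open>By isolation of zeros, every point of \<open>S\<close> has either a neighbourhood on which \<open>f\<close> vanishes or a
  punctured neighbourhood without zeros. Both sets of points are relatively open and they are
  disjoint, so connectedness leaves only the one that contains \<open>t0\<close>.\<close>

theorem real_analytic_identity:
  fixes f :: "real \<Rightarrow> real"
  assumes S: "open S" "connected S"
    and an: "\<And>t. t \<in> S \<Longrightarrow> \<exists>F. (\<lambda>h. f (t + h)) has_fps_expansion F"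
    and t0: "t0 \<in> S" "(\<lambda>h. f (t0 + h)) has_fps_expansion 0"
    and t: "t \<in> S"
  shows "f t = 0"
proof -
  \<comment> \<open>The expansions are centred at the origin, the neighbourhoods at \<open>t\<close>.\<close>
  have shift: "eventually P (nhds t) = eventually (\<lambda>h. P (t + h)) (nhds 0)"
    "eventually P (at t) = eventually (\<lambda>h. P (t + h)) (at 0)" for P and t :: real
    by (simp_all add: nhds_to_0[of t] at_to_0[of t] eventually_filtermap add.commute)
  define A where "A = {t. eventually (\<lambda>s. f s = 0) (nhds t)}"
  define B where "B = {t. eventually (\<lambda>s. f s \<noteq> 0) (at t)} \<inter> S"
  have cover: "t \<in> A \<union> B" if t: "t \<in> S" for t
  proof -
    obtain F where F: "(\<lambda>h. f (t + h)) has_fps_expansion F"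
      using an[OF t] by blast
    show ?thesis
    proof (cases "F = 0")
      case True
      then show ?thesis
        using F by (simp add: A_def shift(1)[of _ t] has_fps_expansion_0_iff)
    next
      case False
      then show ?thesis
        using has_fps_expansion_eventually_nonzero[OF F] t by (simp add: B_def shift(2)[of _ t])
    qed
  qed
  have "open A"
  proof (rule Topological_Spaces.openI)
    fix t assume "t \<in> A"
    then obtain U where "open U" "t \<in> U" "\<And>s. s \<in> U \<Longrightarrow> f s = 0"
      unfolding A_def mem_Collect_eq eventually_nhds by blast
    then show "\<exists>T. open T \<and> t \<in> T \<and> T \<subseteq> A"
      unfolding A_def by (auto simp: eventually_nhds intro!: exI[of _ U])
  qed
  moreover have "open B"
  proof (rule Topological_Spaces.openI)
    fix t assume "t \<in> B"
    then have "eventually (\<lambda>s. f s \<noteq> 0) (at t)" "t \<in> S"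
      by (auto simp: B_def)
    then obtain U where U: "open U" "t \<in> U" "\<And>s. s \<in> U \<Longrightarrow> s \<noteq> t \<Longrightarrow> f s \<noteq> 0"
      unfolding eventually_at_topological by blast
    have "U \<inter> S \<subseteq> B"
    proof
      fix s assume s: "s \<in> U \<inter> S"
      show "s \<in> B"
      proof (cases "s = t")
        case True
        then show ?thesis using \<open>t \<in> B\<close> by simp
      next
        case False
        have "eventually (\<lambda>r. r \<in> U - {t}) (nhds s)"
          using False s U(1) by (intro eventually_nhds_in_open) auto
        then have "eventually (\<lambda>r. f r \<noteq> 0) (at s)"
          unfolding eventually_at_filter by eventually_elim (use U(3) in auto)
        then show ?thesis using s by (simp add: B_def)
      qed
    qed
    then show "\<exists>T. open T \<and> t \<in> T \<and> T \<subseteq> B"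
      using U(1,2) S(1) \<open>t \<in> S\<close> by (intro exI[of _ "U \<inter> S"]) auto
  qed
  moreover have "A \<inter> B \<inter> S = {}"
  proof -
    have False if "t \<in> A" "t \<in> B" for t
    proof -
      have "eventually (\<lambda>s. f s = 0) (at t)"
        using that(1) by (simp add: A_def eventually_at_filter eventually_mono)
      moreover have "eventually (\<lambda>s. f s \<noteq> 0) (at t)"
        using that(2) by (simp add: B_def)
      ultimately have "eventually (\<lambda>s. False) (at t)"
        by eventually_elim simp
      then show False by simp
    qed
    then show ?thesis by blast
  qed
  moreover have "t0 \<in> A"
    using t0(2) by (simp add: A_def shift(1)[of _ t0] has_fps_expansion_0_iff)
  ultimately have "B \<inter> S = {}"
    using S(2) cover t0(1) by (meson connectedD disjoint_iff subsetI)
  with cover[OF t] t have "t \<in> A" by blast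
  then show ?thesis
    unfolding A_def using eventually_nhds_x_imp_x by fastforce
qed

section \<open>Formal power series of an exponential family\<close>

definition cubic_fps :: "real \<Rightarrow> real \<Rightarrow> real \<Rightarrow> real \<Rightarrow> real fps \<Rightarrow> real fps" where
  "cubic_fps a0 a1 a2 a3 Y = fps_const a3 * Y ^ 3 + fps_const a2 * Y\<^sup>2 + fps_const a1 * Y + fps_const a0"

lemma cubic_fps_X_nth: "fps_nth (cubic_fps a0 a1 a2 a3 fps_X) n =
   (if n = 0 then a0 else if n = 1 then a1 else if n = 2 then a2 else if n = 3 then a3 else 0)"
  by (auto simp: cubic_fps_def fps_X_power_nth)

text \<open>\<open>L\<close> stands for the Taylor series at \<open>0\<close> of the Laplace transform of a probability measure. The second
  assumption says that the variance, which is the second derivative of \<open>log L\<close> at \<open>0\<close>, does not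
  vanish; it makes \<open>k' - m0\<close> invertible under composition.\<close>

locale formal_nef =
  fixes L :: "real fps"
  assumes L_0: "fps_nth L 0 = 1"
    and K_2_0: "fps_nth (fps_deriv (fps_deriv L * inverse L)) 0 \<noteq> 0"
begin

text \<open>In terms of \<open>k = log L\<close>: the series of \<open>k'\<close> and \<open>k''\<close> are \<open>K1\<close> and \<open>K2\<close>, and \<open>\<Psi>\<close> is the series of
  \<open>\<psi>(m0 + X)\<close>. Composition with \<open>\<Psi>\<close> changes the variable from \<open>\<theta>\<close> to \<open>m - m0\<close>: it turns \<open>K2\<close> into the
  variance function \<open>V\<close>, the density \<open>exp(\<theta>x - k(\<theta>))\<close> into \<open>\<Phi> x\<close>, and the \<open>j\<close>-th moment \<open>L\<^sup>(\<^sup>j\<^sup>)/L\<close> into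
  \<open>moment_series j\<close>.\<close>

definition K1 :: "real fps" where "K1 = fps_deriv L * inverse L"
definition K2 :: "real fps" where "K2 = fps_deriv K1"
definition m0 :: real where "m0 = fps_nth K1 0"
definition \<Psi> :: "real fps" where "\<Psi> = fps_inv (K1 - fps_const m0)"
definition V :: "real fps" where "V = K2 oo \<Psi>"
definition \<Phi> :: "real \<Rightarrow> real fps" where "\<Phi> x = (fps_exp x * inverse L) oo \<Psi>"
definition moment_series :: "nat \<Rightarrow> real fps" where
  "moment_series j = ((fps_deriv ^^ j) L * inverse L) oo \<Psi>"

lemma \<Psi>_0 [simp]: "fps_nth \<Psi> 0 = 0"
  by (simp add: \<Psi>_def fps_inv_def)

lemma K2_0: "fps_nth K2 0 \<noteq> 0"
  using K_2_0 by (simp add: K2_def K1_def)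

lemma V_0: "fps_nth V 0 \<noteq> 0"
  using K2_0 by (simp add: V_def)

lemma K1_compose_\<Psi>: "K1 oo \<Psi> = fps_const m0 + fps_X"
proof -
  have "(K1 - fps_const m0) oo \<Psi> = fps_X"
    unfolding \<Psi>_def using K2_0 by (intro fps_inv_right) (simp_all add: m0_def K2_def)
  then show ?thesis
    by (simp add: fps_compose_sub_distrib algebra_simps)
qed

lemma \<Psi>_nonzero: "\<Psi> \<noteq> 0"
proof
  assume "\<Psi> = 0"
  then have "fps_nth (K1 oo \<Psi>) 1 = 0" by simp
  then show False by (simp add: K1_compose_\<Psi>)
qed

lemma V_times_deriv_\<Psi>: "V * fps_deriv \<Psi> = 1"
proof -
  have "fps_deriv (K1 oo \<Psi>) = V * fps_deriv \<Psi>"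
    by (simp add: fps_compose_deriv V_def K2_def)
  then show ?thesis by (simp add: K1_compose_\<Psi>)
qed

text \<open>Formal version of \<open>V(m) d/dm = d/d\<theta>\<close>, which holds because \<open>\<psi>' = 1/V\<close>.\<close>

lemma V_times_deriv_compose: "V * fps_deriv (G oo \<Psi>) = fps_deriv G oo \<Psi>"
proof -
  have "V * fps_deriv (G oo \<Psi>) = (V * fps_deriv \<Psi>) * (fps_deriv G oo \<Psi>)"
    by (simp add: fps_compose_deriv mult_ac)
  then show ?thesis by (simp add: V_times_deriv_\<Psi>)
qed

lemma deriv_compose_\<Psi>: "fps_deriv (G oo \<Psi>) = (fps_deriv G / K2) oo \<Psi>"
proof -
  have "((fps_deriv G / K2) oo \<Psi>) * V = ((fps_deriv G / K2) * K2) oo \<Psi>"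
    by (simp add: fps_compose_mult_distrib V_def)
  also have "(fps_deriv G / K2) * K2 = fps_deriv G"
    using K2_0 by (simp add: fps_divide_unit mult.assoc inverse_mult_eq_1)
  finally have "V * ((fps_deriv G / K2) oo \<Psi>) = V * fps_deriv (G oo \<Psi>)"
    by (simp add: V_times_deriv_compose mult.commute)
  moreover have "V \<noteq> 0" using V_0 by auto
  ultimately show ?thesis by simp
qed

lemma deriv_inverse_L: "fps_deriv (inverse L) = - (K1 * inverse L)"
  using L_0 by (simp add: fps_inverse_deriv K1_def power2_eq_square)

lemma \<Phi>_0 [simp]: "fps_nth (\<Phi> x) 0 = 1"
  using L_0 by (simp add: \<Phi>_def)

text \<open>Since \<open>d/d\<theta> exp(\<theta>x - k(\<theta>)) = (x - k'(\<theta>)) exp(\<theta>x - k(\<theta>))\<close> and \<open>k'(\<psi>(m)) = m\<close>. Both the recurrence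
  and the polynomial form of the coefficients come from this equation.\<close>

lemma \<Phi>_ode: "V * fps_deriv (\<Phi> x) = (fps_const (x - m0) - fps_X) * \<Phi> x"
proof -
  have E: "fps_deriv (fps_exp x * inverse L) = (fps_const x - K1) * (fps_exp x * inverse L)"
    by (simp add: deriv_inverse_L algebra_simps)
  have "V * fps_deriv (\<Phi> x) = ((fps_const x - K1) oo \<Psi>) * \<Phi> x"
    unfolding \<Phi>_def V_times_deriv_compose E
    by (rule fps_compose_mult_distrib[OF \<Psi>_0])
  also have "(fps_const x - K1) oo \<Psi> = fps_const (x - m0) - fps_X"
    by (simp add: fps_compose_sub_distrib K1_compose_\<Psi> fps_const_sub[symmetric] del: fps_const_sub)
  finally show ?thesis .
qed

lemma \<Phi>_step:
  "fps_nth (V * fps_deriv (\<Phi> x)) n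
    = (x - m0) * fps_nth (\<Phi> x) n - (if n = 0 then 0 else fps_nth (\<Phi> x) (n - 1))"
  by (simp add: \<Phi>_ode left_diff_distrib)

text \<open>The coefficient of \<open>X\<^sup>k\<close> in the differential equation determines coefficient \<open>k + 1\<close> of
  \<open>\<Phi> x\<close> from the earlier ones, because \<open>V\<close> starts with a nonzero constant. Among them only the
  term \<open>(x - m0)\<close> times the \<open>k\<close>-th coefficient reaches degree \<open>k + 1\<close> in \<open>x\<close>.\<close>

theorem \<Phi>_coefficients_polynomial:
  "\<exists>p. degree p = n \<and> (\<forall>x. fps_nth (\<Phi> x) n = poly p x)"
proof (induction n rule: less_induct)
  case (less n)
  show ?case
  proof (cases n)
    case 0
    then show ?thesis by (intro exI[of _ 1]) simp
  next
    case (Suc k)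
    have "\<forall>i. \<exists>p. i < n \<longrightarrow> degree p = i \<and> (\<forall>x. fps_nth (\<Phi> x) i = poly p x)"
      using less by blast
    then obtain p where p: "\<And>i. i < n \<Longrightarrow> degree (p i) = i"
      "\<And>i x. i < n \<Longrightarrow> fps_nth (\<Phi> x) i = poly (p i) x"
      by metis
    \<comment> \<open>\<open>c\<close> is the factor of the new coefficient; \<open>r\<close> collects the terms that stay of degree at most \<open>k\<close>.\<close>
    define c where "c = fps_nth V 0 * real n"
    have c: "c \<noteq> 0" using V_0 Suc by (simp add: c_def)
    define r where "r = (if k = 0 then 0 else p (k - 1))
        + (\<Sum>i=1..k. smult (fps_nth V i * real (Suc (k - i))) (p (Suc (k - i))))"
    define q where "q = smult (1 / c) ([:- m0, 1:] * p k - r)"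
    have "degree r \<le> k"
      unfolding r_def
    proof (intro degree_add_le degree_sum_le)
      show "degree (if k = 0 then 0 else p (k - 1)) \<le> k"
        using p(1)[of "k - 1"] Suc by simp
      fix i assume "i \<in> {1..k}"
      then show "degree (smult (fps_nth V i * real (Suc (k - i))) (p (Suc (k - i)))) \<le> k"
        using p(1)[of "Suc (k - i)"] Suc by (intro order_trans[OF degree_smult_le]) auto
    qed simp
    moreover have pk: "p k \<noteq> 0"
    proof
      assume "p k = 0"
      then have "k = 0" using p(1)[of k] Suc by simp
      then show False using p(2)[of 0 0] Suc \<open>p k = 0\<close> by simp
    qed
    then have "degree ([:- m0, 1:] * p k) = Suc k"
      using p(1)[of k] Suc by (subst degree_mult_eq) auto
    ultimately have "degree ([:- m0, 1:] * p k - r) = Suc k"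
      by (metis degree_add_eq_left degree_minus diff_conv_add_uminus less_Suc_eq_le)
    then have "degree q = n"
      using c Suc by (simp add: q_def)
    moreover have "fps_nth (\<Phi> x) n = poly q x" for x
    proof -
      have "fps_nth (V * fps_deriv (\<Phi> x)) k
          = (\<Sum>i=0..k. fps_nth V i * (real (Suc (k - i)) * fps_nth (\<Phi> x) (Suc (k - i))))"
        by (simp add: fps_mult_nth)
      also have "\<dots> = c * fps_nth (\<Phi> x) n
          + (\<Sum>i=1..k. fps_nth V i * real (Suc (k - i)) * poly (p (Suc (k - i))) x)"
        using Suc by (subst sum.atLeast_Suc_atMost) (auto simp: c_def p(2) intro!: sum.cong)
      finally have "c * fps_nth (\<Phi> x) n = (x - m0) * poly (p k) x - poly r x"
        unfolding \<Phi>_step using Suc by (auto simp: r_def poly_sum p(2))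
      then show ?thesis
        using c by (simp add: q_def field_simps)
    qed
    ultimately show ?thesis by blast
  qed
qed

definition taylor_poly :: "nat \<Rightarrow> real poly" where
  "taylor_poly n = (SOME p. degree p = n \<and> (\<forall>x. fps_nth (\<Phi> x) n = poly p x))"

lemma degree_taylor_poly: "degree (taylor_poly n) = n"
  and \<Phi>_nth: "fps_nth (\<Phi> x) n = poly (taylor_poly n) x"
  using someI_ex[OF \<Phi>_coefficients_polynomial[of n]] unfolding taylor_poly_def[symmetric] by blast+

lemma taylor_poly_nonzero: "taylor_poly n \<noteq> 0"
proof
  assume "taylor_poly n = 0"
  then have "n = 0" using degree_taylor_poly[of n] by simp
  then show False using \<Phi>_nth[of 0 0] \<open>taylor_poly n = 0\<close> by simp
qed

lemma cubic_fps_compose: "cubic_fps a0 a1 a2 a3 (K1 - fps_const m0) oo \<Psi> = cubic_fps a0 a1 a2 a3 fps_X"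
proof -
  have "(K1 - fps_const m0) oo \<Psi> = fps_X"
    by (simp add: fps_compose_sub_distrib K1_compose_\<Psi>)
  then show ?thesis
    by (simp add: cubic_fps_def fps_compose_add_distrib fps_compose_mult_distrib
        fps_compose_power[symmetric])
qed

text \<open>Composition with \<open>\<Psi>\<close> is injective because \<open>\<Psi> \<noteq> 0\<close>. This moves the question between the variables
  \<open>m - m0\<close> and \<open>\<theta>\<close>.\<close>

lemma V_eq_cubic_iff:
  "V = cubic_fps a0 a1 a2 a3 fps_X \<longleftrightarrow> K2 - cubic_fps a0 a1 a2 a3 (K1 - fps_const m0) = 0"
proof -
  have "(K2 - cubic_fps a0 a1 a2 a3 (K1 - fps_const m0)) oo \<Psi> = V - cubic_fps a0 a1 a2 a3 fps_X"
    by (simp only: fps_compose_sub_distrib cubic_fps_compose V_def)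
  moreover have "(K2 - cubic_fps a0 a1 a2 a3 (K1 - fps_const m0)) oo \<Psi> = 0
      \<longleftrightarrow> K2 - cubic_fps a0 a1 a2 a3 (K1 - fps_const m0) = 0"
    by (subst fps_compose_eq_0_iff) (auto simp: \<Psi>_nonzero)
  ultimately show ?thesis by simp
qed

lemma V_cubic_iff_higher_coefficients_zero:
  "(\<exists>a0 a1 a2 a3. V = cubic_fps a0 a1 a2 a3 fps_X) \<longleftrightarrow> (\<forall>n\<ge>4. fps_nth V n = 0)"
proof
  assume "\<forall>n\<ge>4. fps_nth V n = 0"
  then have "V = cubic_fps (fps_nth V 0) (fps_nth V 1) (fps_nth V 2) (fps_nth V 3) fps_X"
    by (auto simp: fps_eq_iff cubic_fps_X_nth)
  then show "\<exists>a0 a1 a2 a3. V = cubic_fps a0 a1 a2 a3 fps_X" by blast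
qed (auto simp: cubic_fps_X_nth)

lemma cubic_fps_times_deriv_nth:
  assumes "n \<ge> 2"
  shows "fact n * fps_nth (cubic_fps a0 a1 a2 a3 fps_X * fps_deriv G) n
    = a3 * (real n * (real n - 1) * (real n - 2)) * (fact (n - 2) * fps_nth G (n - 2))
      + real n * (a2 * (real n - 1)) * (fact (n - 1) * fps_nth G (n - 1))
      + real n * a1 * (fact n * fps_nth G n) + a0 * (fact (n + 1) * fps_nth G (n + 1))"
proof -
  obtain k where k: "n = Suc (Suc k)"
    using assms by (metis Suc_le_D numeral_2_eq_2 Suc_le_mono)
  show ?thesis
  proof (cases k)
    case 0
    then show ?thesis
      by (simp add: k cubic_fps_def distrib_right mult.assoc fps_X_power_mult_nth
          fps_X_power_mult_right_nth power2_eq_square algebra_simps)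
  next
    case (Suc l)
    show ?thesis
      by (simp add: k Suc cubic_fps_def distrib_right mult.assoc fps_X_power_mult_nth algebra_simps
          eval_nat_numeral)
  qed
qed

text \<open>If \<open>k\<close> is the first index with \<open>fps_nth W k \<noteq> 0\<close>, then the coefficient of \<open>X\<^sup>n\<close>, as a polynomial in
  \<open>x\<close>, has degree \<open>n - k + 1\<close>, since later coefficients of \<open>W\<close> meet \<open>taylor_poly\<close> of smaller index. So it
  cannot vanish for all \<open>x\<close>. Here \<open>n\<close> may be any number \<open>\<ge> k\<close>, which is why knowing only the
  coefficients from \<open>2\<close> onwards is enough.\<close>

lemma zero_if_annihilates:
  assumes "\<And>n x. n \<ge> 2 \<Longrightarrow> fps_nth (W * fps_deriv (\<Phi> x)) n = 0"
  shows "W = 0"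
proof -
  have "fps_nth W k = 0" for k
  proof (induction k rule: less_induct)
    case (less k)
    define n where "n = max 2 k"
    have n: "n \<ge> 2" "k \<le> n" by (auto simp: n_def)
    define s where "s = (\<Sum>i=0..n. smult (fps_nth W i * real (Suc (n - i)))
      (taylor_poly (Suc (n - i))))"
    have "poly s x = fps_nth (W * fps_deriv (\<Phi> x)) n" for x
      by (simp add: s_def poly_sum fps_mult_nth \<Phi>_nth mult_ac)
    then have "poly s = poly 0"
      using assms[OF n(1)] by (simp add: fun_eq_iff)
    then have "s = 0"
      by (simp only: poly_eq_poly_eq_iff)
    then have "0 = coeff s (Suc (n - k))" by simp
    also have "\<dots> = (\<Sum>i=0..n. fps_nth W i * real (Suc (n - i))
        * coeff (taylor_poly (Suc (n - i))) (Suc (n - k)))"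
      by (simp add: s_def coeff_sum)
    also have "\<dots> = (\<Sum>i\<in>{k}. fps_nth W i * real (Suc (n - i))
        * coeff (taylor_poly (Suc (n - i))) (Suc (n - k)))"
    proof (rule sum.mono_neutral_right)
      show "\<forall>i\<in>{0..n} - {k}. fps_nth W i * real (Suc (n - i))
          * coeff (taylor_poly (Suc (n - i))) (Suc (n - k)) = 0"
      proof
        fix i assume i: "i \<in> {0..n} - {k}"
        show "fps_nth W i * real (Suc (n - i)) * coeff (taylor_poly (Suc (n - i))) (Suc (n - k)) = 0"
        proof (cases "i < k")
          case True
          then show ?thesis using less by simp
        next
          case False
          then have "k < i" "i \<le> n" using i by auto
          then have "degree (taylor_poly (Suc (n - i))) < Suc (n - k)"
            by (simp add: degree_taylor_poly diff_less_mono2)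
          then show ?thesis by (simp add: coeff_eq_0)
        qed
      qed
    qed (use n in auto)
    finally have "fps_nth W k * real (Suc (n - k)) * coeff (taylor_poly (Suc (n - k))) (Suc (n - k)) = 0"
      by simp
    moreover have "coeff (taylor_poly (Suc (n - k))) (Suc (n - k)) \<noteq> 0"
      using taylor_poly_nonzero[of "Suc (n - k)"] degree_taylor_poly[of "Suc (n - k)"]
      by (metis leading_coeff_0_iff)
    ultimately show ?case by simp
  qed
  then show ?thesis by (simp add: fps_eq_iff)
qed

text \<open>Multiplied by \<open>n!\<close>, the \<open>n\<close>-th coefficient of \<open>\<Phi>_ode\<close> is the recurrence when \<open>V\<close> is cubic. In general
  the two sides of the recurrence differ by the \<open>n\<close>-th coefficient of
  \<open>(V - cubic) \<cdot> \<Phi>'\<close>, up to \<open>n!\<close>.\<close>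

theorem recurrence_iff:
  "(\<forall>n\<ge>2. \<forall>x. x * (fact n * poly (taylor_poly n) x) =
      a3 * (real n * (real n - 1) * (real n - 2)) * (fact (n - 2) * poly (taylor_poly (n - 2)) x)
      + real n * (a2 * (real n - 1) + 1) * (fact (n - 1) * poly (taylor_poly (n - 1)) x)
      + (real n * a1 + m0) * (fact n * poly (taylor_poly n) x)
      + a0 * (fact (n + 1) * poly (taylor_poly (n + 1)) x)) \<longleftrightarrow> V = cubic_fps a0 a1 a2 a3 fps_X"
  (is "(\<forall>n\<ge>2. \<forall>x. ?rec n x) \<longleftrightarrow> _")
proof -
  have rec: "?rec n x \<longleftrightarrow> fps_nth ((V - cubic_fps a0 a1 a2 a3 fps_X) * fps_deriv (\<Phi> x)) n = 0"
    if n: "n \<ge> 2" for n x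
  proof -
    have fact: "fact n = real n * fact (n - 1)"
      using n by (intro fact_reduce) simp
    have "fact n * fps_nth ((V - cubic_fps a0 a1 a2 a3 fps_X) * fps_deriv (\<Phi> x)) n
      = fact n * ((x - m0) * fps_nth (\<Phi> x) n - fps_nth (\<Phi> x) (n - 1))
        - fact n * fps_nth (cubic_fps a0 a1 a2 a3 fps_X * fps_deriv (\<Phi> x)) n"
      using n by (simp add: left_diff_distrib[of V] \<Phi>_step right_diff_distrib[of "fact n"]
          del: fps_deriv_nth)
    then have "fact n * fps_nth ((V - cubic_fps a0 a1 a2 a3 fps_X) * fps_deriv (\<Phi> x)) n =
       x * (fact n * poly (taylor_poly n) x) -
      (a3 * (real n * (real n - 1) * (real n - 2)) * (fact (n - 2) * poly (taylor_poly (n - 2)) x)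
      + real n * (a2 * (real n - 1) + 1) * (fact (n - 1) * poly (taylor_poly (n - 1)) x)
      + (real n * a1 + m0) * (fact n * poly (taylor_poly n) x)
      + a0 * (fact (n + 1) * poly (taylor_poly (n + 1)) x))"
      unfolding cubic_fps_times_deriv_nth[OF n] \<Phi>_nth by (simp add: algebra_simps fact)
    then show ?thesis by (metis (no_types, lifting) eq_iff_diff_eq_0 fact_nonzero mult_eq_0_iff)
  qed
  show ?thesis
  proof
    assume "\<forall>n\<ge>2. \<forall>x. ?rec n x"
    then have "V - cubic_fps a0 a1 a2 a3 fps_X = 0"
      using rec by (intro zero_if_annihilates) blast
    then show "V = cubic_fps a0 a1 a2 a3 fps_X" by simp
  next
    assume "V = cubic_fps a0 a1 a2 a3 fps_X"
    then have "fps_nth ((V - cubic_fps a0 a1 a2 a3 fps_X) * fps_deriv (\<Phi> x)) n = 0" for n x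
      by simp
    then show "\<forall>n\<ge>2. \<forall>x. ?rec n x" using rec by blast
  qed
qed

lemma moment_series_0: "moment_series 0 = 1"
  using L_0 by (simp add: moment_series_def inverse_mult_eq_1')

lemma moment_series_1: "moment_series 1 = fps_const m0 + fps_X"
  by (simp add: moment_series_def K1_def[symmetric] K1_compose_\<Psi>)

text \<open>With \<open>E\<^sub>j = L\<^sup>(\<^sup>j\<^sup>)/L\<close> one has \<open>E\<^sub>j' = E\<^sub>j\<^sub>+\<^sub>1 - k' E\<^sub>j\<close> in the variable \<open>\<theta>\<close>.\<close>

lemma moment_series_Suc:
  "moment_series (Suc j) = V * fps_deriv (moment_series j) + (fps_const m0 + fps_X) * moment_series j"
proof -
  have "fps_deriv ((fps_deriv ^^ j) L * inverse L)
      = (fps_deriv ^^ Suc j) L * inverse L - K1 * ((fps_deriv ^^ j) L * inverse L)"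
    by (simp add: deriv_inverse_L algebra_simps)
  then have "V * fps_deriv (moment_series j) = moment_series (Suc j) - (K1 oo \<Psi>) * moment_series j"
    unfolding moment_series_def V_times_deriv_compose
    by (simp only: fps_compose_sub_distrib fps_compose_mult_distrib[OF \<Psi>_0])
  then show ?thesis
    by (simp add: K1_compose_\<Psi>)
qed

lemma moment_series_2: "moment_series 2 = V + (fps_const m0 + fps_X)\<^sup>2"
  using moment_series_Suc[of 1] moment_series_1 by (simp add: numeral_2_eq_2)

text \<open>The step of \<open>moment_series_Suc\<close> raises the degree by at most two when \<open>V\<close> is cubic: differentiation
  lowers it by one, and \<open>V\<close> adds three. It starts from degree one at \<open>j = 1\<close>.\<close>

lemma moment_series_degree:
  assumes "\<forall>n\<ge>4. fps_nth V n = 0"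
  shows "n \<ge> 2 * Suc j \<Longrightarrow> fps_nth (moment_series (Suc j)) n = 0"
proof (induction j arbitrary: n)
  case 0
  then show ?case using moment_series_1 by (simp add: fps_X_def)
next
  case (Suc j)
  have "fps_nth (V * fps_deriv (moment_series (Suc j))) n = 0"
    unfolding fps_mult_nth
  proof (rule sum.neutral, rule ballI)
    fix i assume "i \<in> {0..n}"
    show "fps_nth V i * fps_nth (fps_deriv (moment_series (Suc j))) (n - i) = 0"
      using assms Suc.IH[of "Suc (n - i)"] Suc.prems by (cases "i \<ge> 4") auto
  qed
  moreover have "fps_nth ((fps_const m0 + fps_X) * moment_series (Suc j)) n = 0"
    using Suc.IH[of n] Suc.IH[of "n - 1"] Suc.prems by (simp add: distrib_right)
  ultimately show ?case
    unfolding moment_series_Suc[of "Suc j"] fps_add_nth by simp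
qed

end

section \<open>Laplace transform, mean and variance\<close>

text \<open>The moments are not normalised, so that they are the successive derivatives of the Laplace
  transform.\<close>

definition tilted_moment :: "real measure \<Rightarrow> nat \<Rightarrow> real \<Rightarrow> real" where
  "tilted_moment \<mu> j \<theta> = (\<integral>x. x ^ j * exp (\<theta> * x) \<partial>\<mu>)"

definition tilted_mean :: "real measure \<Rightarrow> real \<Rightarrow> real" where
  "tilted_mean \<mu> \<theta> = tilted_moment \<mu> 1 \<theta> / tilted_moment \<mu> 0 \<theta>"

definition tilted_variance :: "real measure \<Rightarrow> real \<Rightarrow> real" where
  "tilted_variance \<mu> \<theta> = tilted_moment \<mu> 2 \<theta> / tilted_moment \<mu> 0 \<theta> - (tilted_mean \<mu> \<theta>)\<^sup>2"

lemma abs_exp_partial_sum_le: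
  fixes y :: real
  shows "\<bar>\<Sum>n<N. y ^ n / fact n\<bar> \<le> exp \<bar>y\<bar>"
proof -
  have "\<bar>\<Sum>n<N. y ^ n / fact n\<bar> \<le> (\<Sum>n<N. \<bar>y\<bar> ^ n /\<^sub>R fact n)"
    by (rule order_trans[OF sum_abs]) (simp add: abs_mult power_abs divide_inverse mult.commute)
  also have "\<dots> \<le> (\<Sum>n. \<bar>y\<bar> ^ n /\<^sub>R fact n)"
    by (rule sum_le_suminf[OF summable_exp_generic]) auto
  finally show ?thesis by (simp add: exp_def)
qed

lemma power_le_exp:
  fixes y :: real
  assumes "0 \<le> y"
  shows "y ^ n \<le> fact n * exp y"
proof -
  have "y ^ n / fact n \<le> (\<Sum>k<Suc n. y ^ k / fact k)"
    using assms by (simp add: sum_nonneg)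
  also have "\<dots> \<le> exp y"
    using abs_exp_partial_sum_le[of y "Suc n"] assms by simp
  finally show ?thesis by (simp add: field_simps)
qed

locale nef_generator =
  fixes \<mu> :: "real measure"
  assumes nef: "\<mu> \<in> nef_measures"
begin

lemma sets_eq [measurable_cong, simp]: "sets \<mu> = sets borel"
  using nef by (simp add: nef_measures_def radon_measure_def)

lemma space_eq [simp]: "space \<mu> = UNIV"
  using sets_eq_imp_space_eq[OF sets_eq] by simp

lemma laplace_finite_iff: "laplace \<mu> \<theta> < \<infinity> \<longleftrightarrow> integrable \<mu> (\<lambda>x. exp (\<theta> * x))"
  by (subst integrable_iff_bounded) (simp add: laplace_def)

lemma open_Theta: "open (Theta \<mu>)"
  by (simp add: Theta_def)

text \<open>Between \<open>a\<close> and \<open>b\<close> one has \<open>exp (t x) \<le> exp (a x) + exp (b x)\<close>, so the set where the Laplace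
  transform is finite is an interval.\<close>

lemma convex_Theta: "convex (Theta \<mu>)"
proof -
  have "is_interval {\<theta>. laplace \<mu> \<theta> < \<infinity>}"
    unfolding is_interval_1 laplace_finite_iff mem_Collect_eq
  proof (intro ballI allI impI)
    fix a b t :: real
    assume "a \<in> {\<theta>. integrable \<mu> (\<lambda>x. exp (\<theta> * x))}" "b \<in> {\<theta>. integrable \<mu> (\<lambda>x. exp (\<theta> * x))}"
      and t: "a \<le> t \<and> t \<le> b"
    then have "integrable \<mu> (\<lambda>x. exp (a * x) + exp (b * x))"
      by (intro Bochner_Integration.integrable_add) simp_all
    moreover have "exp (t * x) \<le> exp (a * x) + exp (b * x)" for x
    proof (cases "0 \<le> x")
      case True
      then have "exp (t * x) \<le> exp (b * x)"
        using t by (simp add: mult_right_mono)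
      then show ?thesis
        using exp_ge_zero[of "a * x"] by linarith
    next
      case False
      then have "exp (t * x) \<le> exp (a * x)"
        using t by (simp add: mult_right_mono_neg)
      then show ?thesis
        using exp_ge_zero[of "b * x"] by linarith
    qed
    ultimately show "integrable \<mu> (\<lambda>x. exp (t * x))"
      by (elim Bochner_Integration.integrable_bound)
        (auto simp: abs_of_nonneg intro!: AE_I2)
  qed
  then show ?thesis
    unfolding Theta_def by (simp add: convex_interior is_interval_convex)
qed

lemma connected_Theta: "connected (Theta \<mu>)"
  using convex_Theta by (rule convex_connected)

lemma exp_abs_integrable:
  assumes "\<theta> \<in> Theta \<mu>"
  obtains e where "e > 0" "integrable \<mu> (\<lambda>x. exp (\<theta> * x) * exp (e * \<bar>x\<bar>))"
proof -
  obtain e where e: "e > 0" "cball \<theta> e \<subseteq> {\<theta>. laplace \<mu> \<theta> < \<infinity>}"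
    using assms by (auto simp: Theta_def mem_interior_cball)
  have "integrable \<mu> (\<lambda>x. exp ((\<theta> + e) * x) + exp ((\<theta> - e) * x))"
  proof (intro Bochner_Integration.integrable_add)
    show "integrable \<mu> (\<lambda>x. exp ((\<theta> + e) * x))" "integrable \<mu> (\<lambda>x. exp ((\<theta> - e) * x))"
      using e laplace_finite_iff by (auto simp: subset_iff dist_norm)
  qed
  moreover have "norm (exp (\<theta> * x) * exp (e * \<bar>x\<bar>)) \<le> norm (exp ((\<theta> + e) * x) + exp ((\<theta> - e) * x))"
    for x
    by (cases "0 \<le> x") (simp_all add: exp_add[symmetric] algebra_simps)
  ultimately have "integrable \<mu> (\<lambda>x. exp (\<theta> * x) * exp (e * \<bar>x\<bar>))"
    by (elim Bochner_Integration.integrable_bound) auto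
  with e(1) show ?thesis by (rule that)
qed

text \<open>One integrable function that dominates all partial sums of the exponential series of \<open>exp (h x)\<close>
  for \<open>\<bar>h\<bar> \<le> e\<close>. Half of the exponential margin available at an interior point absorbs the
  power of \<open>x\<close>.\<close>

lemma moment_dominating_integrable:
  assumes "\<theta> \<in> Theta \<mu>"
  obtains e where "e > 0"
    "\<And>j. integrable \<mu> (\<lambda>x. \<bar>x\<bar> ^ j * exp (\<theta> * x) * exp (e * \<bar>x\<bar>))"
proof -
  obtain d where d: "d > 0" "integrable \<mu> (\<lambda>x. exp (\<theta> * x) * exp (d * \<bar>x\<bar>))"
    using exp_abs_integrable[OF assms] .
  define e where "e = d / 2"
  have e: "e > 0" using d(1) by (simp add: e_def)
  have "integrable \<mu> (\<lambda>x. \<bar>x\<bar> ^ j * exp (\<theta> * x) * exp (e * \<bar>x\<bar>))" for j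
  proof (rule Bochner_Integration.integrable_bound)
    show "integrable \<mu> (\<lambda>x. (fact j / e ^ j) * (exp (\<theta> * x) * exp (d * \<bar>x\<bar>)))"
      using d(2) by (rule integrable_mult_right)
    have "\<bar>x\<bar> ^ j * exp (\<theta> * x) * exp (e * \<bar>x\<bar>)
        \<le> (fact j / e ^ j) * (exp (\<theta> * x) * exp (d * \<bar>x\<bar>))" for x
    proof -
      have "(e * \<bar>x\<bar>) ^ j \<le> fact j * exp (e * \<bar>x\<bar>)"
        using e by (intro power_le_exp) simp
      then have "\<bar>x\<bar> ^ j \<le> (fact j / e ^ j) * exp (e * \<bar>x\<bar>)"
        using e by (simp add: power_mult_distrib field_simps)
      then have "\<bar>x\<bar> ^ j * (exp (\<theta> * x) * exp (e * \<bar>x\<bar>))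
          \<le> ((fact j / e ^ j) * exp (e * \<bar>x\<bar>)) * (exp (\<theta> * x) * exp (e * \<bar>x\<bar>))"
        by (rule mult_right_mono) simp
      also have "\<dots> = (fact j / e ^ j) * (exp (\<theta> * x) * (exp (e * \<bar>x\<bar>) * exp (e * \<bar>x\<bar>)))"
        by simp
      also have "exp (e * \<bar>x\<bar>) * exp (e * \<bar>x\<bar>) = exp (d * \<bar>x\<bar>)"
        by (simp add: exp_add[symmetric] e_def)
      finally show ?thesis by (simp add: mult.assoc)
    qed
    moreover have "0 \<le> fact j / e ^ j" using e by simp
    ultimately show "AE x in \<mu>. norm (\<bar>x\<bar> ^ j * exp (\<theta> * x) * exp (e * \<bar>x\<bar>))
        \<le> norm ((fact j / e ^ j) * (exp (\<theta> * x) * exp (d * \<bar>x\<bar>)))"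
      using e by (intro AE_I2) (simp add: abs_mult)
  qed simp
  with e show ?thesis by (rule that)
qed

lemma integrable_abs_moment:
  assumes "\<theta> \<in> Theta \<mu>"
  shows "integrable \<mu> (\<lambda>x. \<bar>x\<bar> ^ j * exp (\<theta> * x))"
proof -
  obtain e where e: "e > 0"
    "\<And>j. integrable \<mu> (\<lambda>x. \<bar>x\<bar> ^ j * exp (\<theta> * x) * exp (e * \<bar>x\<bar>))"
    using moment_dominating_integrable[OF assms] by blast
  show ?thesis
  proof (rule Bochner_Integration.integrable_bound[OF e(2)[of j]])
    have "\<bar>x\<bar> ^ j * exp (\<theta> * x) * 1 \<le> \<bar>x\<bar> ^ j * exp (\<theta> * x) * exp (e * \<bar>x\<bar>)" for x
      using e(1) by (intro mult_left_mono) simp_all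
    then show "AE x in \<mu>. norm (\<bar>x\<bar> ^ j * exp (\<theta> * x))
        \<le> norm (\<bar>x\<bar> ^ j * exp (\<theta> * x) * exp (e * \<bar>x\<bar>))"
      by (intro AE_I2) (simp add: abs_mult)
  qed simp
qed

lemma integrable_moment:
  assumes "\<theta> \<in> Theta \<mu>"
  shows "integrable \<mu> (\<lambda>x. x ^ j * exp (\<theta> * x))"
  by (rule Bochner_Integration.integrable_bound[OF integrable_abs_moment[OF assms, of j]])
    (auto simp: abs_mult power_abs)

text \<open>Expanding \<open>exp (h x)\<close> and integrating term by term, by dominated convergence. This one
  expansion yields the differentiability, the derivatives and the analyticity of all moments.\<close>

theorem tilted_moment_has_fps_expansion:
  assumes \<theta>: "\<theta> \<in> Theta \<mu>"
  shows "(\<lambda>h. tilted_moment \<mu> j (\<theta> + h)) has_fps_expansion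
    Abs_fps (\<lambda>n. tilted_moment \<mu> (j + n) \<theta> / fact n)"
proof (rule has_fps_expansionI)
  obtain e where e: "e > 0"
    "\<And>j. integrable \<mu> (\<lambda>x. \<bar>x\<bar> ^ j * exp (\<theta> * x) * exp (e * \<bar>x\<bar>))"
    using moment_dominating_integrable[OF \<theta>] by blast
  have "eventually (\<lambda>h. h \<in> {-e<..<e}) (nhds 0)"
    using e(1) by (intro eventually_nhds_in_open) auto
  then show "\<forall>\<^sub>F h in nhds 0.
      (\<lambda>n. fps_nth (Abs_fps (\<lambda>n. tilted_moment \<mu> (j + n) \<theta> / fact n)) n * h ^ n)
        sums tilted_moment \<mu> j (\<theta> + h)"
  proof eventually_elim
    case (elim h)
    define s where "s = (\<lambda>N x. x ^ j * exp (\<theta> * x) * (\<Sum>n<N. (h * x) ^ n / fact n))"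
    have "(\<lambda>N. integral\<^sup>L \<mu> (s N)) \<longlonglongrightarrow> (\<integral>x. x ^ j * exp ((\<theta> + h) * x) \<partial>\<mu>)"
    proof (rule integral_dominated_convergence)
      show "integrable \<mu> (\<lambda>x. \<bar>x\<bar> ^ j * exp (\<theta> * x) * exp (e * \<bar>x\<bar>))"
        by (rule e(2))
      show "AE x in \<mu>. (\<lambda>N. s N x) \<longlonglongrightarrow> x ^ j * exp ((\<theta> + h) * x)"
      proof (intro AE_I2)
        fix x
        have "(\<lambda>n. (h * x) ^ n / fact n) sums exp (h * x)"
          using exp_converges[of "h * x"] by (simp add: divide_inverse mult.commute)
        then have "(\<lambda>N. s N x) \<longlonglongrightarrow> x ^ j * exp (\<theta> * x) * exp (h * x)"
          unfolding sums_def s_def by (rule tendsto_mult_left)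
        then show "(\<lambda>N. s N x) \<longlonglongrightarrow> x ^ j * exp ((\<theta> + h) * x)"
          by (simp add: exp_add distrib_right mult.assoc)
      qed
      show "AE x in \<mu>. norm (s N x) \<le> \<bar>x\<bar> ^ j * exp (\<theta> * x) * exp (e * \<bar>x\<bar>)" for N
      proof (intro AE_I2)
        fix x
        have "\<bar>\<Sum>n<N. (h * x) ^ n / fact n\<bar> \<le> exp \<bar>h * x\<bar>"
          by (rule abs_exp_partial_sum_le)
        also have "\<dots> \<le> exp (e * \<bar>x\<bar>)"
          using elim by (auto simp: abs_mult intro!: mult_right_mono)
        finally show "norm (s N x) \<le> \<bar>x\<bar> ^ j * exp (\<theta> * x) * exp (e * \<bar>x\<bar>)"
          by (simp add: s_def abs_mult power_abs mult_left_mono)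
      qed
    qed (simp_all add: s_def)
    moreover have "integral\<^sup>L \<mu> (s N) = (\<Sum>n<N. tilted_moment \<mu> (j + n) \<theta> / fact n * h ^ n)" for N
    proof -
      have "s N = (\<lambda>x. \<Sum>n<N. (h ^ n / fact n) * (x ^ (j + n) * exp (\<theta> * x)))"
        by (auto simp: s_def sum_distrib_left power_add power_mult_distrib mult_ac fun_eq_iff
            intro!: sum.cong)
      then have "integral\<^sup>L \<mu> (s N)
          = (\<Sum>n<N. \<integral>x. (h ^ n / fact n) * (x ^ (j + n) * exp (\<theta> * x)) \<partial>\<mu>)"
        using integrable_moment[OF \<theta>]
        by (simp only:) (intro Bochner_Integration.integral_sum integrable_mult_right)
      then show ?thesis
        by (simp add: tilted_moment_def mult.commute)
    qed
    ultimately show ?case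
      by (simp add: sums_def tilted_moment_def)
  qed
qed

text \<open>A nonnegative function with at most one zero can only have integral zero if the measure is
  concentrated at that point, which is excluded.\<close>

lemma integral_pos:
  fixes f :: "real \<Rightarrow> real"
  assumes f: "integrable \<mu> f" "\<And>x. 0 \<le> f x" "\<And>x. f x = 0 \<Longrightarrow> x = c"
  shows "0 < (\<integral>x. f x \<partial>\<mu>)"
proof (rule ccontr)
  assume "\<not> ?thesis"
  moreover have "0 \<le> (\<integral>x. f x \<partial>\<mu>)"
    using f(2) by simp
  ultimately have "(\<integral>x. f x \<partial>\<mu>) = 0"
    by simp
  then have "AE x in \<mu>. f x = 0"
    using integral_nonneg_eq_0_iff_AE[OF f(1)] f(2) by simp
  then have "AE x in \<mu>. x = c"
    by eventually_elim (rule f(3))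
  then have "AE x in \<mu>. x \<notin> - {c}"
    by simp
  moreover have "- {c} \<in> sets \<mu>" by simp
  ultimately have "emeasure \<mu> (- {c}) = 0"
    by (simp add: AE_iff_null_sets null_setsD1)
  then show False
    using nef by (auto simp: nef_measures_def)
qed

lemma tilted_moment_0_pos: "\<theta> \<in> Theta \<mu> \<Longrightarrow> 0 < tilted_moment \<mu> 0 \<theta>"
  unfolding tilted_moment_def
  by (rule integral_pos) (use integrable_moment[of \<theta> 0] in auto)

lemma integral_centred_square:
  assumes \<theta>: "\<theta> \<in> Theta \<mu>"
  shows "integrable \<mu> (\<lambda>x. (x - tilted_mean \<mu> \<theta>)\<^sup>2 * exp (\<theta> * x))" (is ?I)
    and "(\<integral>x. (x - tilted_mean \<mu> \<theta>)\<^sup>2 * exp (\<theta> * x) \<partial>\<mu>)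
      = tilted_variance \<mu> \<theta> * tilted_moment \<mu> 0 \<theta>" (is ?E)
proof -
  let ?m = "tilted_mean \<mu> \<theta>" and ?M = "\<lambda>j. tilted_moment \<mu> j \<theta>"
  have "has_bochner_integral \<mu> (\<lambda>x. x ^ 2 * exp (\<theta> * x) - 2 * ?m * (x ^ 1 * exp (\<theta> * x))
      + ?m\<^sup>2 * (x ^ 0 * exp (\<theta> * x))) (?M 2 - 2 * ?m * ?M 1 + ?m\<^sup>2 * ?M 0)"
    unfolding tilted_moment_def
    by (intro has_bochner_integral_add has_bochner_integral_diff has_bochner_integral_mult_right
        has_bochner_integral_integrable integrable_moment[OF \<theta>])
  moreover have "?M 2 - 2 * ?m * ?M 1 + ?m\<^sup>2 * ?M 0 = tilted_variance \<mu> \<theta> * ?M 0"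
    using tilted_moment_0_pos[OF \<theta>]
    by (simp add: tilted_variance_def tilted_mean_def field_simps power2_eq_square)
  moreover have "(\<lambda>x. x ^ 2 * exp (\<theta> * x) - 2 * ?m * (x ^ 1 * exp (\<theta> * x))
      + ?m\<^sup>2 * (x ^ 0 * exp (\<theta> * x))) = (\<lambda>x. (x - ?m)\<^sup>2 * exp (\<theta> * x))"
    by (simp add: fun_eq_iff algebra_simps power2_eq_square)
  ultimately show ?I ?E
    by (simp_all add: has_bochner_integral_iff)
qed

lemma tilted_variance_pos:
  assumes \<theta>: "\<theta> \<in> Theta \<mu>"
  shows "0 < tilted_variance \<mu> \<theta>"
proof -
  have "0 < (\<integral>x. (x - tilted_mean \<mu> \<theta>)\<^sup>2 * exp (\<theta> * x) \<partial>\<mu>)"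
    by (rule integral_pos[where c = "tilted_mean \<mu> \<theta>"])
      (use integral_centred_square(1)[OF \<theta>] in auto)
  then show ?thesis
    using tilted_moment_0_pos[OF \<theta>]
    by (simp add: integral_centred_square(2)[OF \<theta>] zero_less_mult_iff)
qed

lemma laplace_eq_tilted_moment:
  assumes \<theta>: "\<theta> \<in> Theta \<mu>"
  shows "laplace \<mu> \<theta> = ennreal (tilted_moment \<mu> 0 \<theta>)"
  using integrable_moment[OF \<theta>, of 0]
  by (simp add: laplace_def tilted_moment_def nn_integral_eq_integral)

lemma cumulant_eq:
  assumes \<theta>: "\<theta> \<in> Theta \<mu>"
  shows "cumulant \<mu> \<theta> = ln (tilted_moment \<mu> 0 \<theta>)"
  using tilted_moment_0_pos[OF \<theta>] by (simp add: cumulant_def laplace_eq_tilted_moment[OF \<theta>])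

lemma DERIV_tilted_moment:
  assumes \<theta>: "\<theta> \<in> Theta \<mu>"
  shows "(tilted_moment \<mu> j has_real_derivative tilted_moment \<mu> (Suc j) \<theta>) (at \<theta>)"
proof -
  let ?f = "\<lambda>h. tilted_moment \<mu> j (\<theta> + h)"
  note F = tilted_moment_has_fps_expansion[OF \<theta>, of j]
  have "(?f has_real_derivative deriv ?f 0) (at 0)"
    using has_fps_expansion_eventually_DERIV[OF F] by (rule eventually_nhds_x_imp_x)
  moreover have "deriv ?f 0 = tilted_moment \<mu> (Suc j) \<theta>"
    using has_fps_expansion_imp_0_eq_fps_nth_0[OF has_fps_expansion_deriv[OF F], symmetric] by simp
  ultimately show ?thesis
    using DERIV_shift[of "tilted_moment \<mu> j" _ 0 \<theta>] by (simp add: add.commute)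
qed

lemma DERIV_tilted_mean:
  assumes \<theta>: "\<theta> \<in> Theta \<mu>"
  shows "(tilted_mean \<mu> has_real_derivative tilted_variance \<mu> \<theta>) (at \<theta>)"
proof -
  have "((\<lambda>t. tilted_moment \<mu> 1 t / tilted_moment \<mu> 0 t) has_real_derivative
      (tilted_moment \<mu> 2 \<theta> * tilted_moment \<mu> 0 \<theta> - tilted_moment \<mu> 1 \<theta> * tilted_moment \<mu> 1 \<theta>)
        / (tilted_moment \<mu> 0 \<theta> * tilted_moment \<mu> 0 \<theta>)) (at \<theta>)"
    using tilted_moment_0_pos[OF \<theta>] DERIV_tilted_moment[OF \<theta>, of 0] DERIV_tilted_moment[OF \<theta>, of 1]
    by (intro DERIV_divide) (simp_all add: numeral_2_eq_2)
  moreover have "(tilted_moment \<mu> 2 \<theta> * tilted_moment \<mu> 0 \<theta> - tilted_moment \<mu> 1 \<theta> * tilted_moment \<mu> 1 \<theta>)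
        / (tilted_moment \<mu> 0 \<theta> * tilted_moment \<mu> 0 \<theta>) = tilted_variance \<mu> \<theta>"
    using tilted_moment_0_pos[OF \<theta>]
    by (simp add: tilted_variance_def tilted_mean_def field_simps power2_eq_square)
  ultimately show ?thesis
    by (simp add: tilted_mean_def[abs_def])
qed

lemma deriv_cumulant:
  assumes \<theta>: "\<theta> \<in> Theta \<mu>"
  shows "deriv (cumulant \<mu>) \<theta> = tilted_mean \<mu> \<theta>"
proof (rule DERIV_imp_deriv)
  have "((\<lambda>t. ln (tilted_moment \<mu> 0 t)) has_real_derivative tilted_mean \<mu> \<theta>) (at \<theta>)"
    using DERIV_tilted_moment[OF \<theta>, of 0] tilted_moment_0_pos[OF \<theta>]
    by (auto intro!: derivative_eq_intros simp: tilted_mean_def)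
  moreover have "eventually (\<lambda>t. t \<in> Theta \<mu>) (nhds \<theta>)"
    using open_Theta \<theta> by (rule eventually_nhds_in_open)
  then have "eventually (\<lambda>t. cumulant \<mu> t = ln (tilted_moment \<mu> 0 t)) (nhds \<theta>)"
    by eventually_elim (rule cumulant_eq)
  ultimately show "(cumulant \<mu> has_real_derivative tilted_mean \<mu> \<theta>) (at \<theta>)"
    by (simp cong: DERIV_cong_ev)
qed

lemma mean_domain_eq: "mean_domain \<mu> = tilted_mean \<mu> ` Theta \<mu>"
  by (simp add: mean_domain_def deriv_cumulant)

lemma tilted_mean_strict_mono:
  assumes "s \<in> Theta \<mu>" "t \<in> Theta \<mu>" "s < t"
  shows "tilted_mean \<mu> s < tilted_mean \<mu> t"
proof (rule DERIV_pos_imp_increasing[OF assms(3)])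
  fix u assume "s \<le> u" "u \<le> t"
  then have "u \<in> Theta \<mu>"
    using convex_Theta assms(1,2) by (meson is_interval_convex_1 mem_is_interval_1_I)
  then show "\<exists>D. (tilted_mean \<mu> has_real_derivative D) (at u) \<and> 0 < D"
    using DERIV_tilted_mean tilted_variance_pos by blast
qed

lemma inj_on_tilted_mean: "inj_on (tilted_mean \<mu>) (Theta \<mu>)"
  by (rule inj_onI) (metis linorder_less_linear order_less_irrefl tilted_mean_strict_mono)

lemma psi_tilted_mean:
  assumes "\<theta> \<in> Theta \<mu>"
  shows "psi \<mu> (tilted_mean \<mu> \<theta>) = \<theta>"
proof -
  have "inj_on (deriv (cumulant \<mu>)) (Theta \<mu>)"
    using inj_on_tilted_mean by (simp add: deriv_cumulant inj_on_def)
  then show ?thesis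
    unfolding psi_def using assms the_inv_into_f_f by (metis deriv_cumulant)
qed

lemma DERIV_psi:
  assumes \<theta>: "\<theta> \<in> Theta \<mu>"
  shows "(psi \<mu> has_real_derivative inverse (tilted_variance \<mu> \<theta>)) (at (tilted_mean \<mu> \<theta>))"
proof (rule has_field_derivative_inverse_strong_x[where S = "Theta \<mu>" and f = "tilted_mean \<mu>"])
  show "(tilted_mean \<mu> has_real_derivative tilted_variance \<mu> \<theta>) (at (psi \<mu> (tilted_mean \<mu> \<theta>)))"
    using DERIV_tilted_mean[OF \<theta>] by (simp add: psi_tilted_mean[OF \<theta>])
  show "continuous_on (Theta \<mu>) (tilted_mean \<mu>)"
    by (intro DERIV_atLeastAtMost_imp_continuous_on continuous_at_imp_continuous_on ballI)
      (rule DERIV_isCont[OF DERIV_tilted_mean])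
qed (use tilted_variance_pos[OF \<theta>] open_Theta \<theta> in \<open>simp_all add: psi_tilted_mean\<close>)

lemma eventually_psi_in_Theta:
  assumes \<theta>: "\<theta> \<in> Theta \<mu>"
  shows "eventually (\<lambda>m. psi \<mu> m \<in> Theta \<mu> \<and> tilted_mean \<mu> (psi \<mu> m) = m) (nhds (tilted_mean \<mu> \<theta>))"
proof -
  have "open (tilted_mean \<mu> ` Theta \<mu>)"
  proof (rule injective_into_1d_imp_open_map_UNIV[OF open_Theta _ inj_on_tilted_mean])
    show "continuous_on (Theta \<mu>) (tilted_mean \<mu>)"
      by (intro continuous_at_imp_continuous_on ballI) (rule DERIV_isCont[OF DERIV_tilted_mean])
  qed simp_all
  then have "eventually (\<lambda>m. m \<in> tilted_mean \<mu> ` Theta \<mu>) (nhds (tilted_mean \<mu> \<theta>))"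
    using \<theta> by (intro eventually_nhds_in_open) auto
  then show ?thesis
    by eventually_elim (auto simp: psi_tilted_mean)
qed

lemma variance_function_tilted_mean:
  assumes \<theta>: "\<theta> \<in> Theta \<mu>"
  shows "variance_function \<mu> (tilted_mean \<mu> \<theta>) = tilted_variance \<mu> \<theta>"
proof -
  let ?m = "tilted_mean \<mu> \<theta>" and ?M = "tilted_moment \<mu> 0 \<theta>"
  have "variance_function \<mu> ?m = (\<integral>x. exp (\<theta> * x - cumulant \<mu> \<theta>) * (x - ?m)\<^sup>2 \<partial>\<mu>)"
    unfolding variance_function_def element_with_mean_def nef_element_def psi_tilted_mean[OF \<theta>]
    by (subst integral_density) simp_all
  also have "\<dots> = (\<integral>x. (x - ?m)\<^sup>2 * exp (\<theta> * x) / ?M \<partial>\<mu>)"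
    using tilted_moment_0_pos[OF \<theta>] by (simp add: cumulant_eq[OF \<theta>] exp_diff mult.commute)
  also have "\<dots> = tilted_variance \<mu> \<theta>"
    using tilted_moment_0_pos[OF \<theta>] integral_centred_square(2)[OF \<theta>] by simp
  finally show ?thesis .
qed

end

section \<open>Change of generator\<close>

text \<open>Any element of the family generates it: tilting by \<open>\<theta>\<close> translates the parameter and rescales the
  moments by a constant, which cancels in the mean and the variance.\<close>

lemma nef_element_same_family:
  assumes \<nu>: "\<nu> \<in> nef_measures" and \<theta>: "\<theta> \<in> Theta \<nu>"
  defines "\<mu> \<equiv> nef_element \<theta> \<nu>"
  shows "\<mu> \<in> nef_measures" "Theta \<mu> = (\<lambda>t. t - \<theta>) ` Theta \<nu>"
    "tilted_moment \<mu> j t = tilted_moment \<nu> j (\<theta> + t) / tilted_moment \<nu> 0 \<theta>"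
proof -
  interpret \<nu>: nef_generator \<nu> by standard (rule \<nu>)
  let ?c = "cumulant \<nu> \<theta>"
  have c: "exp ?c = tilted_moment \<nu> 0 \<theta>"
    using \<nu>.tilted_moment_0_pos[OF \<theta>] by (simp add: \<nu>.cumulant_eq[OF \<theta>])
  have [measurable_cong, simp]: "sets \<mu> = sets borel"
    by (simp add: \<mu>_def nef_element_def)
  have lap: "laplace \<mu> t = ennreal (exp (- ?c)) * laplace \<nu> (\<theta> + t)" for t
  proof -
    have "laplace \<mu> t = (\<integral>\<^sup>+x. ennreal (exp (\<theta> * x - ?c)) * ennreal (exp (t * x)) \<partial>\<nu>)"
      by (simp add: laplace_def \<mu>_def nef_element_def nn_integral_density)
    also have "\<dots> = (\<integral>\<^sup>+x. ennreal (exp (- ?c)) * ennreal (exp ((\<theta> + t) * x)) \<partial>\<nu>)"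
      by (intro nn_integral_cong) (simp add: ennreal_mult[symmetric] exp_add[symmetric] algebra_simps)
    finally show ?thesis
      by (simp add: laplace_def nn_integral_cmult)
  qed
  have "{t. laplace \<mu> t < \<infinity>} = (\<lambda>t. - \<theta> + t) ` {t. laplace \<nu> t < \<infinity>}"
  proof -
    have "laplace \<mu> t < \<infinity> \<longleftrightarrow> laplace \<nu> (\<theta> + t) < \<infinity>" for t
      by (auto simp: lap ennreal_mult_less_top)
    moreover have "t \<in> (\<lambda>t. - \<theta> + t) ` S \<longleftrightarrow> \<theta> + t \<in> S" for t S
      by (metis (no_types, lifting) add_minus_cancel imageE image_eqI minus_add_cancel)
    ultimately show ?thesis
      by (intro set_eqI) simp
  qed
  then have "Theta \<mu> = (\<lambda>t. - \<theta> + t) ` Theta \<nu>"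
    unfolding Theta_def by (simp only: interior_translation)
  then show Theta: "Theta \<mu> = (\<lambda>t. t - \<theta>) ` Theta \<nu>"
    by simp
  show "tilted_moment \<mu> j t = tilted_moment \<nu> j (\<theta> + t) / tilted_moment \<nu> 0 \<theta>"
  proof -
    have "tilted_moment \<mu> j t = (\<integral>x. exp (\<theta> * x - ?c) * (x ^ j * exp (t * x)) \<partial>\<nu>)"
      unfolding tilted_moment_def \<mu>_def nef_element_def by (subst integral_density) simp_all
    also have "\<dots> = (\<integral>x. (x ^ j * exp ((\<theta> + t) * x)) / exp ?c \<partial>\<nu>)"
      by (intro Bochner_Integration.integral_cong) (simp_all add: exp_diff exp_add distrib_right)
    finally show ?thesis
      by (simp add: tilted_moment_def c[unfolded tilted_moment_def])
  qed
  have "emeasure \<mu> K < \<infinity>" for K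
  proof -
    have "emeasure \<mu> K \<le> emeasure \<mu> (space \<mu>)"
      by (rule emeasure_space)
    also have "\<dots> = laplace \<mu> 0"
      by (simp add: laplace_def)
    also have "\<dots> < \<infinity>"
      using \<theta> by (simp add: lap \<nu>.laplace_eq_tilted_moment ennreal_mult_less_top)
    finally show ?thesis .
  qed
  moreover have "emeasure \<mu> (- {c}) \<noteq> 0" for c
  proof
    assume "emeasure \<mu> (- {c}) = 0"
    then have "- {c} \<in> null_sets \<mu>" by auto
    then have "AE x in \<nu>. x \<notin> - {c}"
      by (simp add: \<mu>_def nef_element_def null_sets_density_iff)
    moreover have "- {c} \<in> sets \<nu>" by simp
    ultimately have "emeasure \<nu> (- {c}) = 0"
      by (simp add: AE_iff_null_sets null_setsD1)
    then show False
      using \<nu> by (auto simp: nef_measures_def)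
  qed
  ultimately show "\<mu> \<in> nef_measures"
    using \<theta> by (auto simp: nef_measures_def radon_measure_def Theta)
qed

lemma nef_element_mean_domain_variance:
  assumes \<nu>: "\<nu> \<in> nef_measures" and \<theta>: "\<theta> \<in> Theta \<nu>"
  defines "\<mu> \<equiv> nef_element \<theta> \<nu>"
  shows "mean_domain \<nu> = mean_domain \<mu>"
    and "m \<in> mean_domain \<nu> \<Longrightarrow> variance_function \<nu> m = variance_function \<mu> m"
    and "0 \<in> Theta \<mu>" and "tilted_moment \<mu> 0 0 = 1"
proof -
  interpret \<nu>: nef_generator \<nu> by standard (rule \<nu>)
  note same = nef_element_same_family[OF \<nu> \<theta>, folded \<mu>_def]
  interpret \<mu>: nef_generator \<mu> by standard (rule same(1))
  have nz: "tilted_moment \<nu> 0 \<theta> \<noteq> 0"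
    using \<nu>.tilted_moment_0_pos[OF \<theta>] by simp
  then have mean: "tilted_mean \<mu> t = tilted_mean \<nu> (\<theta> + t)" for t
    by (simp add: tilted_mean_def same(3))
  moreover have var: "tilted_variance \<mu> t = tilted_variance \<nu> (\<theta> + t)" for t
    using nz by (simp add: tilted_variance_def mean same(3))
  ultimately show "mean_domain \<nu> = mean_domain \<mu>"
    by (simp add: \<nu>.mean_domain_eq \<mu>.mean_domain_eq same(2) image_image)
  show "variance_function \<nu> m = variance_function \<mu> m" if m: "m \<in> mean_domain \<nu>"
  proof -
    obtain t where t: "t \<in> Theta \<nu>" "m = tilted_mean \<nu> t"
      using m by (auto simp: \<nu>.mean_domain_eq)
    then have "t - \<theta> \<in> Theta \<mu>" "m = tilted_mean \<mu> (t - \<theta>)"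
      by (simp_all add: same(2) mean)
    then show ?thesis
      using t \<nu>.variance_function_tilted_mean \<mu>.variance_function_tilted_mean var
      by (metis add_diff_cancel_left' diff_add_cancel add.commute)
  qed
  show "0 \<in> Theta \<mu>" "tilted_moment \<mu> 0 0 = 1"
    using \<theta> nz by (simp_all add: same)
qed

section \<open>Taylor coefficients at the mean\<close>

text \<open>By the change of generator it is enough to study a generator that is itself an element of the
  family, that is, a probability measure with \<open>0\<close> in its parameter set.\<close>

locale nef_member = nef_generator +
  assumes zero_in_Theta: "0 \<in> Theta \<mu>" and total_mass: "tilted_moment \<mu> 0 0 = 1"
begin

definition L :: "real fps" where
  "L = Abs_fps (\<lambda>n. tilted_moment \<mu> n 0 / fact n)"

lemma L_0: "fps_nth L 0 = 1"
  by (simp add: L_def total_mass)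

lemma higher_deriv_L_nth: "fps_nth ((fps_deriv ^^ j) L) n = tilted_moment \<mu> (j + n) 0 / fact n"
proof (induction j arbitrary: n)
  case (Suc j)
  have "fps_nth ((fps_deriv ^^ Suc j) L) n
      = real (Suc n) * (tilted_moment \<mu> (j + Suc n) 0 / fact (Suc n))"
    by (simp add: Suc)
  also have "\<dots> = tilted_moment \<mu> (Suc j + n) 0 / fact n"
    by (simp add: field_simps del: of_nat_Suc)
  finally show ?case .
qed (simp add: L_def)

lemma tilted_moment_expansion_0: "tilted_moment \<mu> j has_fps_expansion (fps_deriv ^^ j) L"
proof -
  have "Abs_fps (\<lambda>n. tilted_moment \<mu> (j + n) 0 / fact n) = (fps_deriv ^^ j) L"
    by (simp add: fps_eq_iff higher_deriv_L_nth)
  then show ?thesis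
    using tilted_moment_has_fps_expansion[OF zero_in_Theta, of j] by simp
qed

lemma tilted_mean_expansion_0: "tilted_mean \<mu> has_fps_expansion fps_deriv L * inverse L"
  using has_fps_expansion_mult[OF tilted_moment_expansion_0[of 1]
      has_fps_expansion_inverse[OF tilted_moment_expansion_0[of 0]]] L_0
  by (simp add: tilted_mean_def[abs_def] divide_inverse)

lemma eventually_in_Theta: "eventually (\<lambda>t. t \<in> Theta \<mu>) (nhds 0)"
  using open_Theta zero_in_Theta by (rule eventually_nhds_in_open)

lemma tilted_variance_expansion_0:
  "tilted_variance \<mu> has_fps_expansion fps_deriv (fps_deriv L * inverse L)"
proof -
  have "eventually (\<lambda>t. deriv (tilted_mean \<mu>) t = tilted_variance \<mu> t) (nhds 0)"
    using eventually_in_Theta by eventually_elim (rule DERIV_imp_deriv[OF DERIV_tilted_mean])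
  then show ?thesis
    using has_fps_expansion_deriv[OF tilted_mean_expansion_0] has_fps_expansion_cong[OF _ refl] by blast
qed

sublocale formal_nef L
proof
  show "fps_nth (fps_deriv (fps_deriv L * inverse L)) 0 \<noteq> 0"
    using has_fps_expansion_imp_0_eq_fps_nth_0[OF tilted_variance_expansion_0, symmetric]
      tilted_variance_pos[OF zero_in_Theta]
    by simp
qed (rule L_0)

lemma m0_eq: "m0 = tilted_mean \<mu> 0"
  using has_fps_expansion_imp_0_eq_fps_nth_0[OF tilted_mean_expansion_0, symmetric]
  by (simp add: m0_def K1_def)

lemma K1_expansion: "tilted_mean \<mu> has_fps_expansion K1"
  using tilted_mean_expansion_0 by (simp add: K1_def)

lemma K2_expansion: "tilted_variance \<mu> has_fps_expansion K2"
  using tilted_variance_expansion_0 by (simp add: K1_def K2_def)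

text \<open>Near \<open>m0\<close>, \<open>(g \<circ> \<psi>)' = (g'/k'') \<circ> \<psi>\<close>. The function \<open>g'/k''\<close> is again analytic at \<open>0\<close>, so the
  induction hypothesis applies to it, and formal composition obeys the same rule
  (\<open>deriv_compose_\<Psi>\<close>).\<close>

theorem higher_deriv_compose_psi:
  assumes "g has_fps_expansion G"
  shows "(deriv ^^ n) (\<lambda>m. g (psi \<mu> m)) m0 = fact n * fps_nth (G oo \<Psi>) n"
  using assms
proof (induction n arbitrary: g G)
  case 0
  then show ?case
    using has_fps_expansion_imp_0_eq_fps_nth_0[OF 0, symmetric]
    by (simp add: m0_eq psi_tilted_mean[OF zero_in_Theta])
next
  case (Suc n)
  have psi_m0: "psi \<mu> m0 = 0"
    by (simp add: m0_eq psi_tilted_mean[OF zero_in_Theta])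
  have "isCont (psi \<mu>) m0"
    unfolding m0_eq by (rule DERIV_isCont[OF DERIV_psi[OF zero_in_Theta]])
  then have "filterlim (psi \<mu>) (nhds 0) (nhds m0)"
    by (metis isCont_def psi_m0 tendsto_at_iff_tendsto_nhds)
  then have "eventually (\<lambda>m. (g has_real_derivative deriv g (psi \<mu> m)) (at (psi \<mu> m))) (nhds m0)"
    using has_fps_expansion_eventually_DERIV[OF Suc.prems] by (rule eventually_compose_filterlim[rotated])
  moreover have "eventually (\<lambda>m. psi \<mu> m \<in> Theta \<mu> \<and> tilted_mean \<mu> (psi \<mu> m) = m) (nhds m0)"
    unfolding m0_eq by (rule eventually_psi_in_Theta[OF zero_in_Theta])
  ultimately have ev: "eventually (\<lambda>m. deriv (\<lambda>m. g (psi \<mu> m)) m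
      = deriv g (psi \<mu> m) / tilted_variance \<mu> (psi \<mu> m)) (nhds m0)"
  proof eventually_elim
    case (elim m)
    have "(psi \<mu> has_real_derivative inverse (tilted_variance \<mu> (psi \<mu> m))) (at m)"
      using DERIV_psi[of "psi \<mu> m"] elim(2) by simp
    with elim(1) have "((\<lambda>m. g (psi \<mu> m)) has_real_derivative
        deriv g (psi \<mu> m) * inverse (tilted_variance \<mu> (psi \<mu> m))) (at m)"
      by (rule DERIV_chain2)
    then show ?case
      by (simp add: DERIV_imp_deriv divide_inverse)
  qed
  have "(\<lambda>t. deriv g t / tilted_variance \<mu> t) has_fps_expansion fps_deriv G / K2"
    using has_fps_expansion_deriv[OF Suc.prems] K2_expansion K2_0 by (rule has_fps_expansion_divide')
  then have "(deriv ^^ n) (\<lambda>m. deriv g (psi \<mu> m) / tilted_variance \<mu> (psi \<mu> m)) m0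
      = fact n * fps_nth ((fps_deriv G / K2) oo \<Psi>) n"
    by (rule Suc.IH)
  also have "\<dots> = fact (Suc n) * fps_nth (G oo \<Psi>) (Suc n)"
    by (simp add: deriv_compose_\<Psi>[symmetric])
  finally show ?case
    by (simp add: funpow_Suc_right higher_deriv_cong_ev[OF ev] del: funpow.simps)
qed

lemma nef_poly_eq: "nef_poly \<mu> m0 n x = fact n * poly (taylor_poly n) x"
proof -
  have "(\<lambda>t. exp (x * t) * inverse (tilted_moment \<mu> 0 t)) has_fps_expansion fps_exp x * inverse L"
    using tilted_moment_expansion_0[of 0] L_0 by (intro fps_expansion_intros) auto
  moreover have "eventually (\<lambda>t. exp (x * t) * inverse (tilted_moment \<mu> 0 t)
      = exp (t * x - cumulant \<mu> t)) (nhds 0)"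
    using eventually_in_Theta
    by eventually_elim
      (simp add: cumulant_eq exp_diff tilted_moment_0_pos divide_inverse mult.commute)
  ultimately have "(\<lambda>t. exp (t * x - cumulant \<mu> t)) has_fps_expansion fps_exp x * inverse L"
    by (simp cong: has_fps_expansion_cong)
  from higher_deriv_compose_psi[OF this]
  show ?thesis
    by (simp add: nef_poly_def nef_density_def \<Phi>_def[symmetric] \<Phi>_nth)
qed

lemma integrable_power: "integrable \<mu> (\<lambda>x. x ^ j)"
  using integrable_moment[OF zero_in_Theta, of j] by simp

lemma integrable_poly: "integrable \<mu> (\<lambda>x. poly q x)"
  unfolding poly_altdef
  by (intro Bochner_Integration.integrable_sum integrable_mult_right integrable_power)

text \<open>Formally, integrating \<open>x\<^sup>j exp(\<theta>x)\<close> over \<open>\<mu>\<close> gives \<open>L\<^sup>(\<^sup>j\<^sup>)(\<theta>)\<close>. Each coefficient of \<open>\<Phi> x\<close> involves only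
  finitely many powers of \<open>x\<close>, so no exchange of limits arises.\<close>

theorem integral_power_times_\<Phi>:
  "(\<integral>x. x ^ j * fps_nth (\<Phi> x) n \<partial>\<mu>) = fps_nth (moment_series j) n"
proof -
  let ?c = "\<lambda>i l. fps_nth (inverse L) (i - l) * fps_nth (\<Psi> ^ i) n / fact l"
  have "(\<integral>x. x ^ j * fps_nth (\<Phi> x) n \<partial>\<mu>)
      = (\<integral>x. (\<Sum>i=0..n. \<Sum>l=0..i. ?c i l * x ^ (j + l)) \<partial>\<mu>)"
    by (intro Bochner_Integration.integral_cong)
      (simp_all add: \<Phi>_def fps_compose_nth fps_mult_nth sum_distrib_left sum_distrib_right
        power_add mult_ac)
  also have "\<dots> = (\<Sum>i=0..n. \<Sum>l=0..i. ?c i l * tilted_moment \<mu> (j + l) 0)"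
    by (simp add: integrable_power Bochner_Integration.integrable_sum tilted_moment_def
        del: times_divide_eq_left)
  also have "\<dots> = fps_nth (moment_series j) n"
    unfolding moment_series_def fps_compose_nth fps_mult_nth higher_deriv_L_nth sum_distrib_right
    by (simp add: mult_ac)
  finally show ?thesis .
qed

lemma integral_nef_poly_product:
  "(\<integral>x. nef_poly \<mu> m0 n x * nef_poly \<mu> m0 q x \<partial>\<mu>)
    = fact n * fact q * (\<Sum>j\<le>q. coeff (taylor_poly q) j * fps_nth (moment_series j) n)"
proof -
  have "(\<integral>x. nef_poly \<mu> m0 n x * nef_poly \<mu> m0 q x \<partial>\<mu>)
      = (\<integral>x. (\<Sum>j\<le>q. fact n * fact q * coeff (taylor_poly q) j * (x ^ j * fps_nth (\<Phi> x) n)) \<partial>\<mu>)"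
    by (intro Bochner_Integration.integral_cong)
      (simp_all add: nef_poly_eq \<Phi>_nth poly_altdef[of "taylor_poly q"] degree_taylor_poly
        sum_distrib_left mult_ac)
  also have "\<dots> = (\<Sum>j\<le>q. fact n * fact q * coeff (taylor_poly q) j * fps_nth (moment_series j) n)"
  proof (subst Bochner_Integration.integral_sum)
    show "integrable \<mu> (\<lambda>x. fact n * fact q * coeff (taylor_poly q) j * (x ^ j * fps_nth (\<Phi> x) n))" for j
      using integrable_poly[of "monom 1 j * taylor_poly n"] by (simp add: \<Phi>_nth poly_monom)
  qed (simp add: integral_power_times_\<Phi>)
  finally show ?thesis
    by (simp add: sum_distrib_left mult_ac)
qed

section \<open>The equivalent conditions\<close>

text \<open>Only \<open>q = 2\<close> is used from left to right: \<open>moment_series 0\<close> and \<open>moment_series 1\<close> have degree at most one,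
  so for \<open>n \<ge> 4\<close> the integral is a nonzero multiple of the \<open>n\<close>-th coefficient of \<open>V\<close>.\<close>

theorem two_orthogonal_iff:
  "two_orthogonal \<mu> (nef_poly \<mu> m0) \<longleftrightarrow> (\<forall>n\<ge>4. fps_nth V n = 0)"
proof
  assume orth: "two_orthogonal \<mu> (nef_poly \<mu> m0)"
  show "\<forall>n\<ge>4. fps_nth V n = 0"
  proof (intro allI impI)
    fix n :: nat assume n: "n \<ge> 4"
    have "(\<integral>x. nef_poly \<mu> m0 n x * nef_poly \<mu> m0 2 x \<partial>\<mu>) = 0"
      using orth n by (simp add: two_orthogonal_def)
    then have "(\<Sum>j\<le>2. coeff (taylor_poly 2) j * fps_nth (moment_series j) n) = 0"
      by (simp add: integral_nef_poly_product)
    moreover have "fps_nth (moment_series 0) n = 0" "fps_nth (moment_series 1) n = 0"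
      "fps_nth (moment_series 2) n = fps_nth V n"
      using n by (auto simp: moment_series_0 moment_series_1 moment_series_2 power2_eq_square distrib_right
          simp flip: One_nat_def)
    ultimately have "coeff (taylor_poly 2) 2 * fps_nth V n = 0"
      by (simp add: numeral_2_eq_2)
    moreover have "coeff (taylor_poly 2) 2 \<noteq> 0"
      using taylor_poly_nonzero[of 2] degree_taylor_poly[of 2] by (metis leading_coeff_0_iff)
    ultimately show "fps_nth V n = 0" by simp
  qed
next
  assume V: "\<forall>n\<ge>4. fps_nth V n = 0"
  show "two_orthogonal \<mu> (nef_poly \<mu> m0)"
    unfolding two_orthogonal_def
  proof (intro conjI allI impI)
    show "integrable \<mu> (\<lambda>x. \<bar>x\<bar> ^ n)" for n
      using integrable_abs_moment[OF zero_in_Theta, of n] by simp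
    show "\<exists>q. \<forall>x. nef_poly \<mu> m0 n x = poly q x" for n
      by (rule exI[of _ "smult (fact n) (taylor_poly n)"]) (simp add: nef_poly_eq)
    show "(\<integral>x. nef_poly \<mu> m0 n x \<partial>\<mu>) = 0" if "n \<ge> 1" for n
      using integral_power_times_\<Phi>[of 0 n] that by (simp add: nef_poly_eq \<Phi>_nth moment_series_0)
    fix n q :: nat assume nq: "1 \<le> n" "1 \<le> q" "2 * q \<le> n"
    have "fps_nth (moment_series j) n = 0" if "j \<le> q" for j
    proof (cases j)
      case 0
      then show ?thesis using nq by (simp add: moment_series_0)
    next
      case (Suc i)
      then show ?thesis using moment_series_degree[OF V, of i n] nq that by simp
    qed
    then show "(\<integral>x. nef_poly \<mu> m0 n x * nef_poly \<mu> m0 q x \<partial>\<mu>) = 0"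
      by (simp add: integral_nef_poly_product)
  qed
qed

theorem cubic_recurrence_iff:
  "cubic_recurrence (nef_poly \<mu> m0) m0 a0 a1 a2 a3 \<longleftrightarrow> V = cubic_fps a0 a1 a2 a3 fps_X"
  unfolding cubic_recurrence_def nef_poly_eq by (rule recurrence_iff)

lemma tilted_moment_quotient_expansion:
  assumes \<theta>: "\<theta> \<in> Theta \<mu>"
  shows "\<exists>F. (\<lambda>h. tilted_moment \<mu> j (\<theta> + h) / tilted_moment \<mu> 0 (\<theta> + h)) has_fps_expansion F"
  using has_fps_expansion_divide'[OF tilted_moment_has_fps_expansion[OF \<theta>, of j]
      tilted_moment_has_fps_expansion[OF \<theta>, of 0]] tilted_moment_0_pos[OF \<theta>]
  by auto

text \<open>Written in the variable \<open>\<theta>\<close>, the left side says that \<open>h = k'' - p(k' - m0)\<close> vanishes on the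
  interval \<open>Theta \<mu>\<close>, where \<open>p\<close> is the cubic. By the identity theorem this holds if and only if the
  power series of \<open>h\<close> at \<open>0\<close> is zero, which is a condition on \<open>V\<close> as a formal power series.\<close>

theorem variance_cubic_iff:
  "(\<forall>m\<in>mean_domain \<mu>. variance_function \<mu> m
      = a3 * (m - m0) ^ 3 + a2 * (m - m0)\<^sup>2 + a1 * (m - m0) + a0)
    \<longleftrightarrow> V = cubic_fps a0 a1 a2 a3 fps_X"
proof -
  define H where "H = K2 - cubic_fps a0 a1 a2 a3 (K1 - fps_const m0)"
  define h where "h = (\<lambda>t. tilted_variance \<mu> t - (a3 * (tilted_mean \<mu> t - m0) ^ 3
    + a2 * (tilted_mean \<mu> t - m0)\<^sup>2 + a1 * (tilted_mean \<mu> t - m0) + a0))"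
  have h: "h has_fps_expansion H"
    unfolding h_def H_def cubic_fps_def
    by (intro fps_expansion_intros K1_expansion K2_expansion)
  have an: "\<exists>F. (\<lambda>u. h (\<theta> + u)) has_fps_expansion F" if \<theta>: "\<theta> \<in> Theta \<mu>" for \<theta>
  proof -
    obtain F1 where F1: "(\<lambda>u. tilted_mean \<mu> (\<theta> + u)) has_fps_expansion F1"
      using tilted_moment_quotient_expansion[OF \<theta>, of 1] by (auto simp: tilted_mean_def)
    obtain F2 where F2: "(\<lambda>u. tilted_moment \<mu> 2 (\<theta> + u) / tilted_moment \<mu> 0 (\<theta> + u)) has_fps_expansion F2"
      using tilted_moment_quotient_expansion[OF \<theta>, of 2] by blast
    show ?thesis
      unfolding h_def tilted_variance_def
      by (rule exI[of _ "F2 - F1\<^sup>2 - (fps_const a3 * (F1 - fps_const m0) ^ 3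
          + fps_const a2 * (F1 - fps_const m0)\<^sup>2 + fps_const a1 * (F1 - fps_const m0) + fps_const a0)"])
        (intro fps_expansion_intros F1 F2)
  qed
  have "(\<forall>m\<in>mean_domain \<mu>. variance_function \<mu> m
      = a3 * (m - m0) ^ 3 + a2 * (m - m0)\<^sup>2 + a1 * (m - m0) + a0) \<longleftrightarrow> (\<forall>\<theta>\<in>Theta \<mu>. h \<theta> = 0)"
    by (simp add: mean_domain_eq variance_function_tilted_mean h_def)
  also have "\<dots> \<longleftrightarrow> H = 0"
  proof
    assume "\<forall>\<theta>\<in>Theta \<mu>. h \<theta> = 0"
    then have "eventually (\<lambda>t. h t = 0) (nhds 0)"
      using eventually_in_Theta by (auto elim: eventually_mono)
    with h show "H = 0" by (rule has_fps_expansion_eventually_zero_imp_0)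
  next
    assume "H = 0"
    with h have "(\<lambda>u. h (0 + u)) has_fps_expansion 0" by simp
    then show "\<forall>\<theta>\<in>Theta \<mu>. h \<theta> = 0"
      using real_analytic_identity[OF open_Theta connected_Theta an zero_in_Theta] by blast
  qed
  finally show ?thesis
    by (simp add: H_def V_eq_cubic_iff)
qed

end

text \<open>A polynomial of degree at most three can be expanded around any centre \<open>c\<close>.\<close>

lemma cubic_NEF_iff:
  "cubic_NEF \<nu> \<longleftrightarrow> (\<exists>a0 a1 a2 a3. \<forall>m\<in>mean_domain \<nu>.
    variance_function \<nu> m = a3 * (m - c) ^ 3 + a2 * (m - c)\<^sup>2 + a1 * (m - c) + a0)"
proof
  assume "cubic_NEF \<nu>"
  then obtain p :: "real poly" where p: "degree p \<le> 3"
    "\<forall>m\<in>mean_domain \<nu>. variance_function \<nu> m = poly p m"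
    by (auto simp: cubic_NEF_def)
  define r where "r = pcompose p [:c, 1:]"
  have "degree r \<le> 3"
    using p(1) by (simp add: r_def degree_pcompose)
  then have r: "poly r y = (\<Sum>i\<le>3. coeff r i * y ^ i)" for y
    unfolding poly_altdef by (intro sum.mono_neutral_left) (auto simp: coeff_eq_0)
  have "poly p m = coeff r 3 * (m - c) ^ 3 + coeff r 2 * (m - c)\<^sup>2 + coeff r 1 * (m - c) + coeff r 0"
    for m
    using r[of "m - c"] by (simp add: r_def poly_pcompose eval_nat_numeral algebra_simps)
  with p(2) show "\<exists>a0 a1 a2 a3. \<forall>m\<in>mean_domain \<nu>.
      variance_function \<nu> m = a3 * (m - c) ^ 3 + a2 * (m - c)\<^sup>2 + a1 * (m - c) + a0"
    by (intro exI[of _ "coeff r 0"] exI[of _ "coeff r 1"] exI[of _ "coeff r 2"] exI[of _ "coeff r 3"])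
      simp
next
  assume "\<exists>a0 a1 a2 a3. \<forall>m\<in>mean_domain \<nu>.
    variance_function \<nu> m = a3 * (m - c) ^ 3 + a2 * (m - c)\<^sup>2 + a1 * (m - c) + a0"
  then obtain a0 a1 a2 a3 where a: "\<forall>m\<in>mean_domain \<nu>.
    variance_function \<nu> m = a3 * (m - c) ^ 3 + a2 * (m - c)\<^sup>2 + a1 * (m - c) + a0"
    by blast
  define q where "q = pcompose [:a0, a1, a2, a3:] [:- c, 1:]"
  have "degree q \<le> 3"
    by (simp add: q_def degree_pcompose)
  moreover have "poly q m = a3 * (m - c) ^ 3 + a2 * (m - c)\<^sup>2 + a1 * (m - c) + a0" for m
    by (simp add: q_def poly_pcompose eval_nat_numeral algebra_simps)
  ultimately show "cubic_NEF \<nu>"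
    using a by (auto simp: cubic_NEF_def)
qed

theorem theorem3p1:
  fixes F :: "real measure set" and \<nu> \<mu> :: "real measure" and m\<^sub>o :: real
  assumes "\<nu> \<in> nef_measures" and "F = NEF \<nu>"
    and "\<mu> \<in> F" and "(\<integral>x. x \<partial>\<mu>) = m\<^sub>o"
  shows "(two_orthogonal \<mu> (nef_poly \<mu> m\<^sub>o) \<longleftrightarrow> cubic_NEF \<nu>) \<and>
    (cubic_NEF \<nu> \<longleftrightarrow> (\<exists>a\<^sub>0 a\<^sub>1 a\<^sub>2 a\<^sub>3. cubic_recurrence (nef_poly \<mu> m\<^sub>o) m\<^sub>o a\<^sub>0 a\<^sub>1 a\<^sub>2 a\<^sub>3)) \<and>
    (\<forall>a\<^sub>0 a\<^sub>1 a\<^sub>2 a\<^sub>3. cubic_recurrence (nef_poly \<mu> m\<^sub>o) m\<^sub>o a\<^sub>0 a\<^sub>1 a\<^sub>2 a\<^sub>3 \<longrightarrow>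
      (\<forall>m \<in> mean_domain \<nu>.
        variance_function \<nu> m =
          a\<^sub>3 * (m - m\<^sub>o) ^ 3 + a\<^sub>2 * (m - m\<^sub>o)\<^sup>2 + a\<^sub>1 * (m - m\<^sub>o) + a\<^sub>0))"
proof -
  obtain \<theta> where \<theta>: "\<theta> \<in> Theta \<nu>" and \<mu>: "\<mu> = nef_element \<theta> \<nu>"
    using assms(2,3) by (auto simp: NEF_def)
  note change = nef_element_mean_domain_variance[OF assms(1) \<theta>, folded \<mu>]
  interpret nef_member \<mu>
    using nef_element_same_family(1)[OF assms(1) \<theta>] change(3,4) by unfold_locales (simp_all add: \<mu>)
  have m0: "m0 = m\<^sub>o"
    using assms(4) total_mass by (simp add: m0_eq tilted_mean_def tilted_moment_def)
  have var: "(\<forall>m\<in>mean_domain \<nu>. variance_function \<nu> m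
      = a3 * (m - m0) ^ 3 + a2 * (m - m0)\<^sup>2 + a1 * (m - m0) + a0)
    \<longleftrightarrow> V = cubic_fps a0 a1 a2 a3 fps_X" for a0 a1 a2 a3
    using variance_cubic_iff change(1,2) by metis
  have "cubic_NEF \<nu> \<longleftrightarrow> (\<exists>a0 a1 a2 a3. V = cubic_fps a0 a1 a2 a3 fps_X)"
    by (simp add: cubic_NEF_iff[where c = m0] var)
  then show ?thesis
    using two_orthogonal_iff V_cubic_iff_higher_coefficients_zero cubic_recurrence_iff var
    unfolding m0 by metis
qed

end
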